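(* Let $\mathcal I$ be a translation invariant, positively $1$-homogeneous nonlocal operator on $\mathbb{R}^n$ of order $2s$ that is elliptic with respect to the class $\mathcal{K}_s=\mathcal K_s(\lambda,\Lambda)$ (see context). Part A. Let $s\in(\frac12,1)$ and let $H:\mathbb{R}^n\to\mathbb{R}$ be a continuous function such that for every $\varepsilon, L>0$ there exists $C=C(\varepsilon,L)$ satisfying $$|H(p)-H(q)|\leq C|p-q|\quad\text{for all } p,q\in\mathbb{R}^n \text{ with } \varepsilon\leq |p|,|q|\leq L.$$ Let $u$ be a viscosity solution to $$-\mathcal I u+H(\nabla u)=0\quad\text{in }\mathbb{R}^n.$$ If for some $\gamma\in[0,\frac{1}{2s})$ and $M>0$ we have $|u(x)|\leq M(1+|x|)^\gamma$ for all $x\in\mathbb{R}^n$, then $u$ is necessarily a constant. Part B. Let $s\in(0,\frac12]$, let $H:\mathbb{R}^n\to\mathbb{R}$ be continuous and let $u$ be a viscosity solution to $-\mathcal I u+H(\nabla u)=0$ in $\mathbb{R}^n$ with $|u(x)|\leq M(1+|x|)^\gamma$ for all $x\in\mathbb{R}^n$, for some $M>0$ and $\gamma\in[0,2s)$. Then $u$ is necessarily a constant, provided one of the following holds: (i) $u$ is uniformly continuous in $\mathbb{R}^n$ and $H$ is locally Lipschitz in the sense that for every $L>0$ there exists $C=C(L)$ with $|H(p)-H(q)|\leq C|p-q|$ for all $|p|,|q|\leq L$; (ii) $H$ is globally Lipschitz.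
   Context: Fix $s\in(0,1)$ and $0<\lambda\leq\Lambda$. $\mathcal{K}_s=\mathcal{K}_s(\lambda,\Lambda)$ is the family of measurable kernels $K:\mathbb{R}^n\setminus\{0\}\to[0,\infty)$ with $\frac{\lambda}{|z|^{n+2s}}\leq K(z)\leq\frac{\Lambda}{|z|^{n+2s}}$ for $z\neq0$ (no symmetry is assumed). With $B$ the unit ball centered at $0$, for $K\in\mathcal{K}_s$ put $$L_Ku(x)=\int_{\mathbb{R}^n}\big[u(x+z)-u(x)-1_{\{2s\in[1,2)\}}1_B(z)\nabla u(x)\cdot z\big]K(z)\,dz .$$ Let $\omega_s(z)=(1+|z|)^{-n-2s}$, and let $L^1(\omega_s)$ be the functions integrable against $\omega_s$. $\mathcal I$ is a nonlocal operator which is translation invariant ($\mathcal I u_h(x)=\mathcal I u(x+h)$ for all $x,h$, where $u_h=u(\cdot+h)$), positively $1$-homogeneous, and elliptic with respect to $\mathcal{K}_s$, i.e. $$\inf_{K\in\mathcal{K}_s}(L_Ku(x)-L_Kv(x))\leq\mathcal I u(x)-\mathcal I v(x)\leq\sup_{K\in\mathcal{K}_s}(L_Ku(x)-L_Kv(x))$$ whenever $u,v\in C^{1,1}(x)\cap L^1(\omega_s)$ (where $C^{1,1}(x)$ means $C^{1,1}$ at the point $x$). Viscosity solutions: let $\Omega\subseteq\mathbb{R}^n$ be open and consider $-\mathcal I u+H(x,u,\nabla u)=0$ in $\Omega$, with $H$ continuous. A measurable $u\in L^1(\omega_s)$, upper (resp. lower) semicontinuous in $\bar\Omega$, is a viscosity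 subsolution (resp. supersolution) if for each $x_0\in\Omega$ and $\varphi\in C^2(B_r(x_0))$, for some $r>0$, with $u(x_0)=\varphi(x_0)$ and $u\leq\varphi$ (resp. $u\geq\varphi$) in $B_r(x_0)$, one has $-\mathcal I v(x_0)+H(x_0,u(x_0),\nabla\varphi(x_0))\leq0$ (resp. $\geq0$), where $v=\varphi$ in $B_r(x_0)$ and $v=u$ elsewhere. A viscosity solution is both a sub- and a supersolution. *)

theory Defs
  imports "HOL-Analysis.Analysis"
begin

text \<open>
  Throughout, \<open>'a\<close> is a Euclidean space of dimension \<open>n = DIM('a)\<close>; for \<open>'a = real ^ 'n\<close> this is
  \<open>CARD('n)\<close>.
\<close>

text \<open>Kernels live on the punctured space. They are represented by functions on the whole space whose
  value at \<open>0\<close> is irrelevant. Nonnegativity off \<open>0\<close> follows from the lower bound when \<open>lam > 0\<close>.\<close>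

definition kernels :: "real \<Rightarrow> real \<Rightarrow> real \<Rightarrow> ('a::euclidean_space \<Rightarrow> real) set" where
  "kernels s lam Lam =
    {K. K \<in> borel_measurable (lebesgue_on (- {0})) \<and>
        (\<forall>z. z \<noteq> 0 \<longrightarrow>
          lam / norm z powr (real DIM('a) + 2 * s) \<le> K z \<and>
          K z \<le> Lam / norm z powr (real DIM('a) + 2 * s))}"

definition grad :: "('a::euclidean_space \<Rightarrow> real) \<Rightarrow> 'a \<Rightarrow> 'a" where
  "grad u x = (THE D. GDERIV u x :> D)"

definition lin_op ::
    "real \<Rightarrow> ('a::euclidean_space \<Rightarrow> real) \<Rightarrow> ('a \<Rightarrow> real) \<Rightarrow> 'a \<Rightarrow> real" where
  "lin_op s K u x =
    (LINT z|lebesgue.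
      (u (x + z) - u x
        - of_bool (2 * s \<in> {1..<2}) * indicator (ball 0 1) z * (grad u x \<bullet> z)) * K z)"

definition weight :: "real \<Rightarrow> 'a::euclidean_space \<Rightarrow> real" where
  "weight s z = (1 + norm z) powr (- real DIM('a) - 2 * s)"

definition weighted_L1 :: "real \<Rightarrow> ('a::euclidean_space \<Rightarrow> real) set" where
  "weighted_L1 s =
    {u. u \<in> borel_measurable lebesgue \<and> integrable lebesgue (\<lambda>z. u z * weight s z)}"

definition C11_at :: "'a::euclidean_space \<Rightarrow> ('a \<Rightarrow> real) set" where
  "C11_at x =
    {u. \<exists>p C. \<exists>r>0. \<forall>y\<in>ball x r. \<bar>u y - u x - p \<bullet> (y - x)\<bar> \<le> C * (norm (y - x))\<^sup>2}"

text \<open>A nonlocal operator \<open>I\<close> is a total function in the logic, but \<open>I u x\<close> is meaningful only if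
  \<open>u \<in> C11_at x \<inter> weighted_L1 s\<close>. All hypotheses on \<open>I\<close> are restricted to such \<open>u\<close> and \<open>x\<close>.\<close>

definition translation_invariant ::
    "real \<Rightarrow> (('a::euclidean_space \<Rightarrow> real) \<Rightarrow> 'a \<Rightarrow> real) \<Rightarrow> bool" where
  "translation_invariant s I \<longleftrightarrow>
    (\<forall>u x h. u \<in> C11_at (x + h) \<inter> weighted_L1 s \<longrightarrow> I (\<lambda>y. u (y + h)) x = I u (x + h))"

definition positively_homogeneous ::
    "real \<Rightarrow> (('a::euclidean_space \<Rightarrow> real) \<Rightarrow> 'a \<Rightarrow> real) \<Rightarrow> bool" where
  "positively_homogeneous s I \<longleftrightarrow>
    (\<forall>u x. \<forall>t>0. u \<in> C11_at x \<inter> weighted_L1 s \<longrightarrow> I (\<lambda>y. t * u y) x = t * I u x)"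

text \<open>On the functions considered, the infimum and supremum below are over bounded sets of reals
  (nonempty if \<open>lam \<le> Lam\<close>).\<close>

definition elliptic ::
    "real \<Rightarrow> real \<Rightarrow> real \<Rightarrow> (('a::euclidean_space \<Rightarrow> real) \<Rightarrow> 'a \<Rightarrow> real) \<Rightarrow> bool" where
  "elliptic s lam Lam I \<longleftrightarrow>
    (\<forall>x. \<forall>u \<in> C11_at x \<inter> weighted_L1 s. \<forall>v \<in> C11_at x \<inter> weighted_L1 s.
      (INF K\<in>kernels s lam Lam. lin_op s K u x - lin_op s K v x) \<le> I u x - I v x \<and>
      I u x - I v x \<le> (SUP K\<in>kernels s lam Lam. lin_op s K u x - lin_op s K v x))"

definition usc_on :: "'a::topological_space set \<Rightarrow> ('a \<Rightarrow> real) \<Rightarrow> bool" where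
  "usc_on S u \<longleftrightarrow> (\<forall>x\<in>S. \<forall>a>u x. \<forall>\<^sub>F y in at x within S. u y < a)"

definition lsc_on :: "'a::topological_space set \<Rightarrow> ('a \<Rightarrow> real) \<Rightarrow> bool" where
  "lsc_on S u \<longleftrightarrow> (\<forall>x\<in>S. \<forall>a<u x. \<forall>\<^sub>F y in at x within S. a < u y)"

text \<open>\<open>g\<close> is the gradient and \<open>g'\<close> the Hessian; only used for open \<open>S\<close>.\<close>

definition C2_on :: "'a::euclidean_space set \<Rightarrow> ('a \<Rightarrow> real) \<Rightarrow> bool" where
  "C2_on S f \<longleftrightarrow>
    (\<exists>(g :: 'a \<Rightarrow> 'a) (g' :: 'a \<Rightarrow> 'a \<Rightarrow>\<^sub>L 'a).
      (\<forall>x\<in>S. GDERIV f x :> g x \<and> (g has_derivative blinfun_apply (g' x)) (at x)) \<and>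
      continuous_on S g')"

definition glue :: "'a::euclidean_space \<Rightarrow> real \<Rightarrow> ('a \<Rightarrow> real) \<Rightarrow> ('a \<Rightarrow> real) \<Rightarrow> 'a \<Rightarrow> real" where
  "glue x0 r \<phi> u = (\<lambda>y. if y \<in> ball x0 r then \<phi> y else u y)"

text \<open>Viscosity sub- and supersolutions of \<open>- I u + H(x, u, grad u) = 0\<close> in \<open>\<Omega>\<close>. A function that is
  \<open>C\<^sup>2\<close> in the open ball may fail to be integrable near its boundary, in which case
  \<open>I (glue x0 r \<phi> u) x0\<close> has no meaning; such pairs \<open>(\<phi>, r)\<close> are not tested. They become admissible
  when \<open>r\<close> is decreased.\<close>

definition visc_subsolution ::
    "real \<Rightarrow> (('a::euclidean_space \<Rightarrow> real) \<Rightarrow> 'a \<Rightarrow> real) \<Rightarrow> ('a \<Rightarrow> real \<Rightarrow> 'a \<Rightarrow> real) \<Rightarrow>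
      'a set \<Rightarrow> ('a \<Rightarrow> real) \<Rightarrow> bool" where
  "visc_subsolution s I H \<Omega> u \<longleftrightarrow>
    u \<in> weighted_L1 s \<and> usc_on (closure \<Omega>) u \<and>
    (\<forall>x0\<in>\<Omega>. \<forall>r>0. \<forall>\<phi>.
      C2_on (ball x0 r) \<phi> \<and> u x0 = \<phi> x0 \<and> (\<forall>y\<in>ball x0 r. u y \<le> \<phi> y) \<and>
      glue x0 r \<phi> u \<in> weighted_L1 s \<longrightarrow>
      - I (glue x0 r \<phi> u) x0 + H x0 (u x0) (grad \<phi> x0) \<le> 0)"

definition visc_supersolution ::
    "real \<Rightarrow> (('a::euclidean_space \<Rightarrow> real) \<Rightarrow> 'a \<Rightarrow> real) \<Rightarrow> ('a \<Rightarrow> real \<Rightarrow> 'a \<Rightarrow> real) \<Rightarrow>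
      'a set \<Rightarrow> ('a \<Rightarrow> real) \<Rightarrow> bool" where
  "visc_supersolution s I H \<Omega> u \<longleftrightarrow>
    u \<in> weighted_L1 s \<and> lsc_on (closure \<Omega>) u \<and>
    (\<forall>x0\<in>\<Omega>. \<forall>r>0. \<forall>\<phi>.
      C2_on (ball x0 r) \<phi> \<and> u x0 = \<phi> x0 \<and> (\<forall>y\<in>ball x0 r. \<phi> y \<le> u y) \<and>
      glue x0 r \<phi> u \<in> weighted_L1 s \<longrightarrow>
      0 \<le> - I (glue x0 r \<phi> u) x0 + H x0 (u x0) (grad \<phi> x0))"

definition visc_solution ::
    "real \<Rightarrow> (('a::euclidean_space \<Rightarrow> real) \<Rightarrow> 'a \<Rightarrow> real) \<Rightarrow> ('a \<Rightarrow> real \<Rightarrow> 'a \<Rightarrow> real) \<Rightarrow>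
      'a set \<Rightarrow> ('a \<Rightarrow> real) \<Rightarrow> bool" where
  "visc_solution s I H \<Omega> u \<longleftrightarrow> visc_subsolution s I H \<Omega> u \<and> visc_supersolution s I H \<Omega> u"

end

theory Submission
  imports Defs
begin

text \<open>
  The proof doubles variables. Let \<open>b x = (1 + |x|\<^sup>2) powr (\<theta> / 2)\<close> with \<open>\<gamma> < \<theta> \<le> 1\<close>, \<open>\<theta> < 2 * s\<close>, and
  suppose that \<open>u x - u y > \<phi> |x - y|\<close> for some \<open>x, y\<close>. Then
  \<open>u x - u y - \<phi> |x - y| - \<epsilon> * (b x + b y)\<close> has a positive maximum for small \<open>\<epsilon> > 0\<close>, at a pair with
  \<open>1 + |x| + |y| \<le> C * \<epsilon> powr (- 1 / (\<theta> - \<gamma>))\<close>. Put \<open>a = x - y\<close>. Moving both points by the same \<open>z\<close> leaves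
  \<open>\<phi> |x - y|\<close> unchanged, so \<open>z \<mapsto> u (x + z) - u (y + z)\<close> is at most its value at \<open>0\<close> up to increments
  of \<open>\<epsilon> * b\<close>. Moving one point at a time gains in addition \<open>\<phi> |a + z| + \<phi> |a - z| - 2 * \<phi> |a|\<close>, which is
  strictly negative for \<open>z\<close> near \<open>a\<close> because \<open>\<phi> (2 * r) < 2 * \<phi> r\<close>. Ellipticity and the two viscosity
  inequalities then bound this gain, integrated against the kernel, by \<open>C * \<epsilon>\<close>; the difference of the
  Hamiltonians is \<open>O(\<epsilon>)\<close> as the gradients of the two test functions differ by \<open>O(\<epsilon>)\<close>.

  For \<open>s > 1/2\<close> the choice \<open>\<phi> r = \<delta> * (r + r / (1 + r powr \<tau>))\<close> keeps the gradients in an annulus, and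
  \<open>|a| \<le> C * (1 + |x| + |y|) powr \<gamma>\<close>, so that the gain is at least \<open>c * \<epsilon> powr q\<close> with \<open>q < 1\<close> exactly
  when \<open>2 * s * \<gamma> < 1\<close> (and \<open>\<tau>\<close> is small). For \<open>s \<le> 1/2\<close> one takes \<open>\<phi> r = d + \<delta> * r powr \<theta>\<close> with
  \<open>\<theta>\<close> close to \<open>2 * s\<close>; under uniform continuity \<open>d > 0\<close> keeps \<open>|a|\<close> away from \<open>0\<close>, hence the gradients
  bounded. In both cases \<open>\<epsilon> \<rightarrow> 0\<close> gives a contradiction, and then \<open>\<delta>, d \<rightarrow> 0\<close>.
\<close>

section \<open>Integrability of powers of the norm\<close>

lemma borel_measurable_norm_powr:
  "(\<lambda>z::'a::real_normed_vector. norm z powr c) \<in> borel_measurable borel"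
  by (intro powr_real_measurable borel_measurable_norm measurable_ident_sets) auto

lemma borel_measurable_lebesgueI:
  fixes f :: "'a::euclidean_space \<Rightarrow> 'b::topological_space"
  shows "f \<in> borel_measurable borel \<Longrightarrow> f \<in> borel_measurable lebesgue"
  by (auto intro: measurable_completion)

text \<open>Pointwise, \<open>f\<close> is at most the series of \<open>c k\<close> times the
  indicator of \<open>A k\<close>, which integrates termwise. The \<open>A k\<close> may overlap, so
  concentric balls with their known volumes can replace annuli.\<close>

lemma integrable_of_countable_cover:
  fixes f :: "'a \<Rightarrow> real"
  assumes f: "f \<in> borel_measurable M" "\<And>z. 0 \<le> f z"
    and A: "\<And>k::nat. A k \<in> fmeasurable M" and c: "\<And>k. 0 \<le> c k"
    and cov: "\<And>z. z \<in> space M \<Longrightarrow> f z \<noteq> 0 \<Longrightarrow> \<exists>k. z \<in> A k \<and> f z \<le> c k"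
    and sm: "summable (\<lambda>k. c k * measure M (A k))"
  shows "integrable M f"
proof (rule integrableI_nonneg)
  have "(\<integral>\<^sup>+z. f z \<partial>M) \<le> (\<integral>\<^sup>+z. (\<Sum>k. ennreal (c k) * indicator (A k) z) \<partial>M)"
  proof (rule nn_integral_mono)
    fix z assume z: "z \<in> space M"
    show "ennreal (f z) \<le> (\<Sum>k. ennreal (c k) * indicator (A k) z)"
    proof (cases "f z = 0")
      case False
      with cov z obtain k where k: "z \<in> A k" "f z \<le> c k" by blast
      have "ennreal (f z) \<le> (\<Sum>j\<in>{k}. ennreal (c j) * indicator (A j) z)"
        using k by (simp add: ennreal_leI)
      also have "\<dots> \<le> (\<Sum>k. ennreal (c k) * indicator (A k) z)"
        by (rule sum_le_suminf) auto
      finally show ?thesis .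
    qed simp
  qed
  also have "\<dots> = (\<Sum>k. \<integral>\<^sup>+z. ennreal (c k) * indicator (A k) z \<partial>M)"
    using A by (intro nn_integral_suminf) auto
  also have "\<dots> = (\<Sum>k. ennreal (c k * measure M (A k)))"
    using A c by (intro suminf_cong)
      (simp add: nn_integral_cmult_indicator fmeasurableD emeasure_eq_measure2 ennreal_mult')
  also have "\<dots> = ennreal (\<Sum>k. c k * measure M (A k))"
    using sm c by (intro suminf_ennreal2) auto
  also have "\<dots> < \<infinity>" by simp
  finally show "(\<integral>\<^sup>+z. f z \<partial>M) < \<infinity>" .
qed (use f in auto)

text \<open>Dyadic shells: for |z| between 2^(-k-1) and 2^(-k), the bound for the integrand times
  the volume of the ball of radius 2^(-k) is a constant times 2^(-\<alpha> k), and these terms form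
  a geometric series.\<close>

lemma integrable_norm_powr_ball:
  assumes "0 < \<alpha>"
  shows "integrable lebesgue
    (\<lambda>z::'a::euclidean_space. indicator (ball 0 1) z * norm z powr (\<alpha> - real DIM('a)))"
proof -
  define n where "n = real DIM('a)"
  define A where "A k = cball (0::'a) (2 powr - real k)" for k
  define c where "c k = 2 powr (- real k * \<alpha>) * 2 powr ((real k + 1) * n)" for k
  define V where "V = unit_ball_vol n"
  have n0: "0 \<le> n" by (simp add: n_def)
  have mA: "measure lebesgue (A k) = V * 2 powr (- real k * n)" for k
    by (simp add: A_def V_def n_def content_cball powr_realpow[symmetric] powr_powr)
  show ?thesis unfolding n_def[symmetric]
  proof (rule integrable_of_countable_cover[where A = A and c = c])
    show "A k \<in> fmeasurable lebesgue" for k by (simp add: A_def)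
    show "0 \<le> c k" for k by (simp add: c_def)
    have eq: "(\<lambda>k. c k * measure lebesgue (A k)) = (\<lambda>k. V * 2 powr n * (2 powr - \<alpha>) ^ k)"
    proof
      fix k
      have "c k * measure lebesgue (A k)
        = V * 2 powr (- real k * \<alpha> + (real k + 1) * n + - real k * n)"
        by (simp only: c_def mA powr_add mult_ac)
      also have "- real k * \<alpha> + (real k + 1) * n + - real k * n = n + - \<alpha> * real k"
        by (simp add: algebra_simps)
      also have "V * 2 powr \<dots> = V * 2 powr n * (2 powr - \<alpha>) ^ k"
        by (simp add: powr_diff divide_inverse powr_realpow[symmetric] powr_powr flip: powr_minus)
      finally show "c k * measure lebesgue (A k) = V * 2 powr n * (2 powr - \<alpha>) ^ k" .
    qed
    show "summable (\<lambda>k. c k * measure lebesgue (A k))"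
      unfolding eq using assms
      by (intro summable_mult summable_geometric) (auto simp: powr_less_one)
    fix z :: 'a
    assume "indicator (ball 0 1) z * norm z powr (\<alpha> - n) \<noteq> 0"
    then have z: "0 < norm z" "norm z < 1"
      by (auto simp: indicator_def split: if_splits)
    define k where "k = nat \<lfloor>- log 2 (norm z)\<rfloor>"
    have "0 \<le> - log 2 (norm z)" using z by simp
    then have k: "real k \<le> - log 2 (norm z)" "- log 2 (norm z) < real k + 1"
      unfolding k_def by linarith+
    have k1: "norm z \<le> 2 powr - real k"
      using k(1) z by (simp add: log_le_iff[symmetric] le_minus_iff)
    have k2: "2 powr - (real k + 1) \<le> norm z"
      using k(2) z by (subst le_log_iff[symmetric]) auto
    \<comment> \<open>The sign of \<alpha> - n is unknown, so the factors are bounded separately: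
      |z|^\<alpha> at the outer radius, |z|^(-n) at the inner one.\<close>
    have "norm z powr (\<alpha> - n) = norm z powr \<alpha> * norm z powr (- n)"
      by (simp flip: powr_add)
    also have "\<dots> \<le> (2 powr - real k) powr \<alpha> * (2 powr - (real k + 1)) powr (- n)"
      using k1 k2 z assms n0 by (intro mult_mono powr_mono2 powr_mono2') auto
    also have "\<dots> = c k" by (simp add: c_def powr_powr algebra_simps)
    finally have "indicator (ball 0 1) z * norm z powr (\<alpha> - n) \<le> c k" using z by simp
    with k1 show "\<exists>k. z \<in> A k \<and> indicator (ball 0 1) z * norm z powr (\<alpha> - n) \<le> c k"
      by (auto simp: A_def)
  qed (auto intro!: borel_measurable_lebesgueI borel_measurable_times borel_measurable_norm_powr borel_measurable_indicator)
qed

text \<open>The same dyadic argument with radii 2^k. The exponent is negative, so the inner radius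
  gives the bound, and the terms again decay like 2^(-\<alpha> k).\<close>

lemma integrable_norm_powr_outside_ball:
  assumes "0 < \<alpha>"
  shows "integrable lebesgue
    (\<lambda>z::'a::euclidean_space. indicator (- ball 0 1) z * norm z powr (- \<alpha> - real DIM('a)))"
proof -
  define n where "n = real DIM('a)"
  define A where "A k = cball (0::'a) (2 powr (real k + 1))" for k
  define c where "c k = 2 powr (real k * (- \<alpha> - n))" for k
  define V where "V = unit_ball_vol n"
  have n0: "0 \<le> n" by (simp add: n_def)
  have mA: "measure lebesgue (A k) = V * 2 powr ((real k + 1) * n)" for k
    by (simp add: A_def V_def n_def content_cball powr_realpow[symmetric] powr_powr)
  show ?thesis unfolding n_def[symmetric]
  proof (rule integrable_of_countable_cover[where A = A and c = c])
    show "A k \<in> fmeasurable lebesgue" for k by (simp add: A_def)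
    show "0 \<le> c k" for k by (simp add: c_def)
    have eq: "(\<lambda>k. c k * measure lebesgue (A k)) = (\<lambda>k. V * 2 powr n * (2 powr - \<alpha>) ^ k)"
    proof
      fix k
      have "c k * measure lebesgue (A k)
        = V * 2 powr (real k * (- \<alpha> - n) + (real k + 1) * n)"
        by (simp only: c_def mA powr_add mult_ac)
      also have "real k * (- \<alpha> - n) + (real k + 1) * n = n + - \<alpha> * real k"
        by (simp add: algebra_simps)
      also have "V * 2 powr \<dots> = V * 2 powr n * (2 powr - \<alpha>) ^ k"
        by (simp add: powr_diff divide_inverse powr_realpow[symmetric] powr_powr flip: powr_minus)
      finally show "c k * measure lebesgue (A k) = V * 2 powr n * (2 powr - \<alpha>) ^ k" .
    qed
    show "summable (\<lambda>k. c k * measure lebesgue (A k))"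
      unfolding eq using assms
      by (intro summable_mult summable_geometric) (auto simp: powr_less_one)
    fix z :: 'a
    assume "indicator (- ball 0 1) z * norm z powr (- \<alpha> - n) \<noteq> 0"
    then have z: "1 \<le> norm z"
      by (auto simp: indicator_def split: if_splits)
    define k where "k = nat \<lfloor>log 2 (norm z)\<rfloor>"
    have "0 \<le> log 2 (norm z)" using z by (subst zero_le_log_cancel_iff) auto
    then have k: "real k \<le> log 2 (norm z)" "log 2 (norm z) < real k + 1"
      unfolding k_def by linarith+
    have k1: "norm z \<le> 2 powr (real k + 1)"
      using k(2) z by (subst log_le_iff[symmetric]) auto
    have k2: "2 powr real k \<le> norm z"
      using k(1) z by (subst le_log_iff[symmetric]) auto
    have "norm z powr (- \<alpha> - n) \<le> (2 powr real k) powr (- \<alpha> - n)"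
      using k2 n0 assms by (intro powr_mono2') auto
    also have "\<dots> = c k" by (simp add: c_def powr_powr)
    finally have "indicator (- ball 0 1) z * norm z powr (- \<alpha> - n) \<le> c k" using z by simp
    with k1 show "\<exists>k. z \<in> A k \<and> indicator (- ball 0 1) z * norm z powr (- \<alpha> - n) \<le> c k"
      by (auto simp: A_def)
  qed (auto intro!: borel_measurable_lebesgueI borel_measurable_times borel_measurable_norm_powr borel_measurable_indicator)
qed

text \<open>Against the weight the growth leaves the exponent \<gamma> - n - 2s < -n at infinity; on
  the unit ball any constant bound is enough.\<close>

lemma growth_imp_weighted_L1:
  fixes u :: "'a::euclidean_space \<Rightarrow> real"
  assumes u: "u \<in> borel_measurable borel" and g: "\<gamma> < 2 * s"
    and b: "\<And>x. \<bar>u x\<bar> \<le> M * (1 + norm x) powr \<gamma>"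
  shows "u \<in> weighted_L1 s"
proof -
  let ?n = "real DIM('a)"
  let ?G = "\<lambda>z::'a. \<bar>M\<bar> * (2 powr \<bar>\<gamma> - ?n - 2 * s\<bar> * indicator (ball 0 1) z
      + indicator (- ball 0 1) z * norm z powr (- (2 * s - \<gamma>) - ?n))"
  have "integrable lebesgue ?G"
    using g integrable_norm_powr_outside_ball[of "2 * s - \<gamma>", where 'a = 'a]
    by (intro integrable_mult_right Bochner_Integration.integrable_add integrable_real_indicator)
      (auto simp: emeasure_lborel_ball_finite[unfolded infinity_ennreal_def])
  then have "integrable lebesgue (\<lambda>z. u z * weight s z)"
  proof (rule Bochner_Integration.integrable_bound)
    show "(\<lambda>z. u z * weight s z) \<in> borel_measurable lebesgue"
      unfolding weight_def using u by (intro borel_measurable_times) (auto intro: measurable_completion)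
    have "norm (u z * weight s z) \<le> norm (?G z)" for z
    proof -
      have M0: "0 \<le> M" using b[of 0] by simp
      have "norm (u z * weight s z) \<le> M * (1 + norm z) powr \<gamma> * (1 + norm z) powr (- ?n - 2 * s)"
        using b[of z] by (simp add: weight_def abs_mult mult_right_mono)
      also have "\<dots> = M * (1 + norm z) powr (\<gamma> - ?n - 2 * s)"
        by (simp add: mult.assoc add_diff_eq flip: powr_add)
      finally have 1: "norm (u z * weight s z) \<le> M * (1 + norm z) powr (\<gamma> - ?n - 2 * s)" .
      show ?thesis
      proof (cases "norm z < 1")
        case True
        have "(1 + norm z) powr (\<gamma> - ?n - 2 * s) \<le> (1 + norm z) powr \<bar>\<gamma> - ?n - 2 * s\<bar>"
          by (intro powr_mono) auto
        also have "\<dots> \<le> 2 powr \<bar>\<gamma> - ?n - 2 * s\<bar>"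
          using True by (intro powr_mono2) auto
        finally have "M * (1 + norm z) powr (\<gamma> - ?n - 2 * s) \<le> M * 2 powr \<bar>\<gamma> - ?n - 2 * s\<bar>"
          using M0 by (rule mult_left_mono)
        with 1 True M0 show ?thesis by simp
      next
        case False
        then have "(1 + norm z) powr (\<gamma> - ?n - 2 * s) \<le> norm z powr (\<gamma> - ?n - 2 * s)"
          using g by (intro powr_mono2') auto
        from mult_left_mono[OF this M0] 1 False M0 show ?thesis
          by (simp add: algebra_simps)
      qed
    qed
    then show "AE z in lebesgue. norm (u z * weight s z) \<le> norm (?G z)" by simp
  qed
  with u show ?thesis by (auto simp: weighted_L1_def intro: measurable_completion)
qed

section \<open>Functions of class \<open>C2_on\<close> and \<open>C11_at\<close>\<close>

lemma GDERIV_unique: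
  assumes "GDERIV f x :> D" "GDERIV f x :> D'"
  shows "D = D'"
proof -
  have "(\<lambda>h. h \<bullet> D) = (\<lambda>h. h \<bullet> D')"
    using assms unfolding gderiv_def by (rule has_derivative_unique)
  then show ?thesis by (simp add: fun_eq_iff vector_eq_ldot)
qed

lemma grad_eqI: "GDERIV f x :> D \<Longrightarrow> grad f x = D"
  unfolding grad_def by (rule the_equality) (auto intro: GDERIV_unique simp del: gderiv_deriv)

lemma GDERIV_transform:
  assumes "GDERIV f x :> D" "open S" "x \<in> S" "\<And>y. y \<in> S \<Longrightarrow> f y = g y"
  shows "GDERIV g x :> D"
  using assms unfolding gderiv_def by (auto intro: has_derivative_transform_within_open)

lemma GDERIV_translate:
  assumes "GDERIV f (x + h) :> D"
  shows "GDERIV (\<lambda>y. f (y + h)) x :> D"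
proof -
  have "((\<lambda>y. y + h) has_derivative (\<lambda>k. k)) (at x)"
    by (auto intro!: derivative_eq_intros)
  from diff_chain_at[OF this] assms show ?thesis
    unfolding gderiv_def o_def by blast
qed

lemma C2_on_const: "C2_on S (\<lambda>x. c)"
  unfolding C2_on_def
  by (intro exI[of _ "\<lambda>x. 0"]) (auto simp: GDERIV_const zero_blinfun.rep_eq)

lemma C2_on_add:
  assumes "C2_on S f" "C2_on S g"
  shows "C2_on S (\<lambda>x. f x + g x)"
proof -
  obtain f1 f2 g1 g2 where *: "\<forall>x\<in>S. GDERIV f x :> f1 x \<and> (f1 has_derivative blinfun_apply (f2 x)) (at x)"
    "continuous_on S f2"
    "\<forall>x\<in>S. GDERIV g x :> g1 x \<and> (g1 has_derivative blinfun_apply (g2 x)) (at x)"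
    "continuous_on S g2"
    using assms unfolding C2_on_def by blast
  show ?thesis unfolding C2_on_def
    by (rule exI[of _ "\<lambda>x. f1 x + g1 x"], rule exI[of _ "\<lambda>x. f2 x + g2 x"])
      (use * in \<open>auto simp: plus_blinfun.rep_eq intro!: GDERIV_add has_derivative_add continuous_on_add\<close>)
qed

lemma C2_on_cmult:
  assumes "C2_on S f"
  shows "C2_on S (\<lambda>x. c * f x)"
proof -
  obtain f1 f2 where *: "\<forall>x\<in>S. GDERIV f x :> f1 x \<and> (f1 has_derivative blinfun_apply (f2 x)) (at x)"
    "continuous_on S f2"
    using assms unfolding C2_on_def by blast
  have "GDERIV (\<lambda>x. c * f x) x :> c *\<^sub>R f1 x" if "x \<in> S" for x
    using * that GDERIV_mult[OF GDERIV_const] by fastforce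
  then show ?thesis unfolding C2_on_def
    by (intro exI[of _ "\<lambda>x. c *\<^sub>R f1 x"] exI[of _ "\<lambda>x. c *\<^sub>R f2 x"])
      (use * in \<open>auto simp: scaleR_blinfun.rep_eq intro!: has_derivative_scaleR_right continuous_intros\<close>)
qed

lemma C2_on_imp_continuous_on:
  assumes "C2_on S f" shows "continuous_on S f"
  using assms unfolding C2_on_def gderiv_def
  using continuous_at_imp_continuous_on has_derivative_continuous by fast

lemma GDERIV_comp_sqnorm:
  assumes "(F has_real_derivative D) (at (c + (norm (x - y))\<^sup>2))"
  shows "GDERIV (\<lambda>x. F (c + (norm (x - y))\<^sup>2)) x :> (2 * D) *\<^sub>R (x - y)"
proof -
  have "GDERIV (\<lambda>x. c + (norm (x - y))\<^sup>2) x :> 2 *\<^sub>R (x - y)"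
    unfolding gderiv_def power2_norm_eq_inner
    by (auto intro!: derivative_eq_intros simp: inner_commute)
  from GDERIV_DERIV_compose[OF this assms] show ?thesis by (simp add: mult.commute)
qed

text \<open>The Hessian is 2 F1 Id + 4 F2 (x - y) (x - y)^T. The squared norm avoids the singularity
  of |x - y| at y: for F smooth on the positive axis, the composition is smooth everywhere if c = 1
  and away from y if c = 0.\<close>

lemma C2_on_comp_sqnorm:
  fixes y :: "'a::euclidean_space"
  assumes F: "\<And>t. t \<in> T \<Longrightarrow> (F has_real_derivative F1 t) (at t)"
    "\<And>t. t \<in> T \<Longrightarrow> (F1 has_real_derivative F2 t) (at t)" "continuous_on T F2"
    and S: "\<And>x. x \<in> S \<Longrightarrow> c + (norm (x - y))\<^sup>2 \<in> T"
  shows "C2_on S (\<lambda>x. F (c + (norm (x - y))\<^sup>2))"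
proof -
  let ?q = "\<lambda>x. c + (norm (x - y))\<^sup>2"
  let ?g = "\<lambda>x. (2 * F1 (?q x)) *\<^sub>R (x - y)"
  let ?h = "\<lambda>x. (2 * F1 (?q x)) *\<^sub>R id_blinfun + (4 * F2 (?q x)) *\<^sub>R
      (blinfun_scaleR_left (x - y) o\<^sub>L blinfun_inner_left (x - y))"
  have "GDERIV (\<lambda>x. F (?q x)) x :> ?g x" if "x \<in> S" for x
    using GDERIV_comp_sqnorm F(1) S that by blast
  moreover have "(?g has_derivative blinfun_apply (?h x)) (at x)" if "x \<in> S" for x
  proof -
    have "GDERIV (\<lambda>x. F1 (?q x)) x :> (2 * F2 (?q x)) *\<^sub>R (x - y)"
      using GDERIV_comp_sqnorm F(2) S that by blast
    then show ?thesis
      unfolding gderiv_def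
      by (auto intro!: derivative_eq_intros ext
        simp: plus_blinfun.rep_eq scaleR_blinfun.rep_eq algebra_simps inner_commute)
  qed
  moreover have "continuous_on S ?h"
  proof -
    have q: "continuous_on S ?q" by (intro continuous_intros)
    have F1: "continuous_on T F1"
      using F(2) DERIV_isCont by (blast intro: continuous_at_imp_continuous_on)
    have "continuous_on S (\<lambda>x. F1 (?q x))" "continuous_on S (\<lambda>x. F2 (?q x))"
      using S by (auto intro!: continuous_on_compose2[OF F1 q] continuous_on_compose2[OF F(3) q])
    then show ?thesis
      by (intro continuous_intros)
  qed
  ultimately show ?thesis unfolding C2_on_def
    by (intro exI[of _ ?g] exI[of _ ?h]) blast
qed

text \<open>Mean value inequality for \<open>f\<close> minus its linear part on the ball of radius
  |y - x| about x, where the derivative is at most C |y - x|.\<close>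

lemma taylor2_bound:
  fixes g :: "'a::euclidean_space \<Rightarrow> 'a"
  assumes f: "\<And>y. y \<in> cball x r \<Longrightarrow> GDERIV f y :> g y"
    and lip: "\<And>y. y \<in> cball x r \<Longrightarrow> norm (g y - g x) \<le> C * norm (y - x)"
    and y: "y \<in> cball x r"
  shows "\<bar>f y - f x - g x \<bullet> (y - x)\<bar> \<le> C * (norm (y - x))\<^sup>2"
proof (cases "y = x")
  case False
  let ?B = "cball x (norm (y - x))"
  have sub: "?B \<subseteq> cball x r" using y by (auto simp: dist_norm norm_minus_commute)
  have "norm ((\<lambda>y. f y - g x \<bullet> y) y - (\<lambda>y. f y - g x \<bullet> y) x) \<le> (C * norm (y - x)) * norm (y - x)"
  proof (rule differentiable_bound[where S = ?B and f' = "\<lambda>w h. h \<bullet> g w - g x \<bullet> h"])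
    fix w assume w: "w \<in> ?B"
    then have "w \<in> cball x r" using sub by auto
    from f[OF this] have fw: "(f has_derivative (\<lambda>h. h \<bullet> g w)) (at w)" unfolding gderiv_def .
    show "((\<lambda>y. f y - g x \<bullet> y) has_derivative (\<lambda>h. h \<bullet> g w - g x \<bullet> h)) (at w within ?B)"
      by (rule has_derivative_at_withinI,
          rule has_derivative_diff[OF fw has_derivative_inner_right[OF has_derivative_ident]])
    have C: "0 \<le> C" using order_trans[OF norm_ge_zero lip[OF y]] False
      by (simp add: zero_le_mult_iff)
    have "norm (g w - g x) \<le> C * norm (w - x)" using lip \<open>w \<in> cball x r\<close> by blast
    also have "\<dots> \<le> C * norm (y - x)" using w C
      by (intro mult_left_mono) (auto simp: dist_norm norm_minus_commute)
    finally have *: "norm (g w - g x) \<le> C * norm (y - x)" .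
    show "onorm (\<lambda>h. h \<bullet> g w - g x \<bullet> h) \<le> C * norm (y - x)"
    proof (rule onorm_le)
      fix h
      have "h \<bullet> g w - g x \<bullet> h = (g w - g x) \<bullet> h" by (simp add: algebra_simps inner_commute)
      then have "norm (h \<bullet> g w - g x \<bullet> h) \<le> norm (g w - g x) * norm h"
        using Cauchy_Schwarz_ineq2 by simp
      also have "\<dots> \<le> C * norm (y - x) * norm h" using * by (intro mult_right_mono) auto
      finally show "norm (h \<bullet> g w - g x \<bullet> h) \<le> C * norm (y - x) * norm h" .
    qed
  qed (auto simp: dist_norm norm_minus_commute)
  then show ?thesis by (simp add: power2_eq_square inner_diff_right algebra_simps)
qed simp

text \<open>The Hessian is continuous, hence bounded on the compact half ball, so the gradient is
  Lipschitz there and \<open>taylor2_bound\<close> applies.\<close>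

lemma C2_on_ball_taylor:
  fixes x :: "'a::euclidean_space"
  assumes "C2_on (ball x r) f" "0 < r"
  obtains C \<delta> where "0 < \<delta>" "\<delta> < r" "0 \<le> C"
    "\<And>y. y \<in> cball x \<delta> \<Longrightarrow> \<bar>f y - f x - grad f x \<bullet> (y - x)\<bar> \<le> C * (norm (y - x))\<^sup>2"
proof -
  obtain g g' where *: "\<And>x'. x' \<in> ball x r \<Longrightarrow> GDERIV f x' :> g x'"
    "\<And>x'. x' \<in> ball x r \<Longrightarrow> (g has_derivative blinfun_apply (g' x')) (at x')"
    "continuous_on (ball x r) g'"
    using assms unfolding C2_on_def by blast
  have sub: "cball x (r/2) \<subseteq> ball x r" using \<open>0 < r\<close> by auto
  have "compact (g' ` cball x (r/2))"
    using *(3) sub by (intro compact_continuous_image) (auto intro: continuous_on_subset)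
  then obtain C where C: "\<And>w. w \<in> cball x (r/2) \<Longrightarrow> norm (g' w) \<le> C"
    by (metis bounded_iff compact_imp_bounded imageI)
  have C0: "0 \<le> C" using order_trans[OF norm_ge_zero C[of x]] \<open>0 < r\<close> by simp
  show ?thesis
  proof
    fix y assume y: "y \<in> cball x (r/2)"
    have "\<bar>f y - f x - g x \<bullet> (y - x)\<bar> \<le> C * (norm (y - x))\<^sup>2"
    proof (rule taylor2_bound[OF _ _ y])
      fix w assume w: "w \<in> cball x (r/2)"
      then show "GDERIV f w :> g w" using * sub by auto
      show "norm (g w - g x) \<le> C * norm (w - x)"
      proof (rule differentiable_bound[where S = "cball x (r/2)" and f' = "\<lambda>w. blinfun_apply (g' w)"])
        fix v assume v: "v \<in> cball x (r/2)"
        then show "(g has_derivative blinfun_apply (g' v)) (at v within cball x (r/2))"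
          using *(2) sub by (blast intro: has_derivative_at_withinI)
        show "onorm (blinfun_apply (g' v)) \<le> C" using C[OF v] by (simp add: norm_blinfun.rep_eq)
      qed (use w assms in auto)
    qed
    moreover have "grad f x = g x" using * assms by (intro grad_eqI) auto
    ultimately show "\<bar>f y - f x - grad f x \<bullet> (y - x)\<bar> \<le> C * (norm (y - x))\<^sup>2" by simp
  qed (use assms C0 in auto)
qed

lemma C2_on_GDERIV_grad:
  assumes "C2_on S f" "x \<in> S" shows "GDERIV f x :> grad f x"
  using assms grad_eqI unfolding C2_on_def by metis

lemma C2_on_imp_C11_at:
  fixes x :: "'a::euclidean_space"
  assumes "C2_on (ball x r) f" "0 < r" shows "f \<in> C11_at x"
proof -
  obtain C \<delta> where "0 < \<delta>"
    "\<And>y. y \<in> cball x \<delta> \<Longrightarrow> \<bar>f y - f x - grad f x \<bullet> (y - x)\<bar> \<le> C * (norm (y - x))\<^sup>2"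
    by (rule C2_on_ball_taylor[OF assms]) blast
  then have "\<forall>y\<in>ball x \<delta>. \<bar>f y - f x - grad f x \<bullet> (y - x)\<bar> \<le> C * (norm (y - x))\<^sup>2"
    by (simp add: less_imp_le)
  with \<open>0 < \<delta>\<close> show ?thesis unfolding C11_at_def by blast
qed

lemma C11_at_cong:
  assumes "f \<in> C11_at x" "0 < r" "\<And>y. y \<in> ball x r \<Longrightarrow> g y = f y"
  shows "g \<in> C11_at x"
proof -
  obtain p C \<rho> where "0 < \<rho>" and *: "\<forall>y\<in>ball x \<rho>. \<bar>f y - f x - p \<bullet> (y - x)\<bar> \<le> C * (norm (y - x))\<^sup>2"
    using assms(1) unfolding C11_at_def by blast
  have "\<forall>y\<in>ball x (min \<rho> r). \<bar>g y - g x - p \<bullet> (y - x)\<bar> \<le> C * (norm (y - x))\<^sup>2"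
    using * assms(2,3) by simp
  moreover have "0 < min \<rho> r" using \<open>0 < \<rho>\<close> assms(2) by simp
  ultimately show ?thesis unfolding C11_at_def by blast
qed

lemma C11_at_translate:
  assumes "f \<in> C11_at (x + h)" shows "(\<lambda>y. f (y + h)) \<in> C11_at x"
proof -
  obtain p C \<rho> where "0 < \<rho>"
    and *: "\<forall>y\<in>ball (x + h) \<rho>. \<bar>f y - f (x + h) - p \<bullet> (y - (x + h))\<bar> \<le> C * (norm (y - (x + h)))\<^sup>2"
    using assms unfolding C11_at_def by blast
  have "\<bar>f (y + h) - f (x + h) - p \<bullet> (y - x)\<bar> \<le> C * (norm (y - x))\<^sup>2" if "y \<in> ball x \<rho>" for y
    using *[rule_format, of "y + h"] that by (simp add: dist_norm)
  with \<open>0 < \<rho>\<close> show ?thesis unfolding C11_at_def by blast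
qed

text \<open>The quadratic bound forces differentiability with the vector of \<open>C11_at\<close> as
  gradient, so the description \<open>grad\<close> in \<open>lin_op\<close> denotes that
  vector.\<close>

lemma C11_at_GDERIV:
  fixes x :: "'a::euclidean_space"
  assumes "f \<in> C11_at x"
  obtains C \<delta> where "0 < \<delta>" "0 \<le> C" "GDERIV f x :> grad f x"
    "\<And>y. y \<in> ball x \<delta> \<Longrightarrow> \<bar>f y - f x - grad f x \<bullet> (y - x)\<bar> \<le> C * (norm (y - x))\<^sup>2"
proof -
  obtain p C r where r: "0 < r"
    and b: "\<And>y. y \<in> ball x r \<Longrightarrow> \<bar>f y - f x - p \<bullet> (y - x)\<bar> \<le> C * (norm (y - x))\<^sup>2"
    using assms unfolding C11_at_def by blast
  have b': "\<bar>f y - f x - p \<bullet> (y - x)\<bar> \<le> \<bar>C\<bar> * (norm (y - x))\<^sup>2" if "y \<in> ball x r" for y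
    by (rule order_trans[OF b[OF that]]) (intro mult_right_mono, auto)
  have "GDERIV f x :> p"
    unfolding gderiv_def has_derivative_at_alt
  proof (intro conjI allI impI)
    fix e :: real assume e: "0 < e"
    let ?d = "min r (e / (\<bar>C\<bar> + 1))"
    have "norm (f y - f x - (y - x) \<bullet> p) \<le> e * norm (y - x)" if y: "norm (y - x) < ?d" for y
    proof -
      have "norm (f y - f x - (y - x) \<bullet> p) \<le> \<bar>C\<bar> * norm (y - x) * norm (y - x)"
        using b'[of y] y by (simp add: dist_norm norm_minus_commute inner_commute power2_eq_square)
      also have "\<dots> \<le> e * norm (y - x)"
      proof (rule mult_right_mono)
        have "norm (y - x) * (\<bar>C\<bar> + 1) < e" using y by (simp add: pos_less_divide_eq)
        moreover have "norm (y - x) * (\<bar>C\<bar> + 1) = \<bar>C\<bar> * norm (y - x) + norm (y - x)"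
          by (simp add: algebra_simps)
        ultimately show "\<bar>C\<bar> * norm (y - x) \<le> e" using norm_ge_zero[of "y - x"] by linarith
      qed simp
      finally show ?thesis .
    qed
    moreover have "0 < ?d" using r e by simp
    ultimately show "\<exists>d>0. \<forall>y. norm (y - x) < d \<longrightarrow> norm (f y - f x - (y - x) \<bullet> p) \<le> e * norm (y - x)" by blast
  qed (rule bounded_linear_inner_left)
  with b' r show ?thesis using that[of r "\<bar>C\<bar>"] by (simp add: grad_eqI)
qed

section \<open>Ellipticity for test functions\<close>

text \<open>Common shape of the increment bounds: exponent \<mu> near 0 and \<theta> at infinity.
  Division by |z|^(n + 2s) leaves an integrable function when \<theta> < 2s < \<mu>.\<close>

definition powr_majorant :: "real \<Rightarrow> real \<Rightarrow> 'a::euclidean_space \<Rightarrow> real" where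
  "powr_majorant \<mu> \<theta> z =
    indicator (ball 0 1) z * norm z powr \<mu> + indicator (- ball 0 1) z * norm z powr \<theta>"

lemma powr_majorant_nonneg: "0 \<le> powr_majorant \<mu> \<theta> z"
  by (simp add: powr_majorant_def)

lemma integrable_powr_majorant:
  assumes "2 * s < \<mu>" "\<theta> < 2 * s"
  shows "integrable lebesgue
    (\<lambda>z::'a::euclidean_space. powr_majorant \<mu> \<theta> z / norm z powr (real DIM('a) + 2 * s))"
proof -
  have "(\<lambda>z::'a. powr_majorant \<mu> \<theta> z / norm z powr (real DIM('a) + 2 * s))
      = (\<lambda>z. indicator (ball 0 1) z * norm z powr ((\<mu> - 2 * s) - real DIM('a)) +
          indicator (- ball 0 1) z * norm z powr (- (2 * s - \<theta>) - real DIM('a)))"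
  proof -
    have "\<mu> - 2 * s - real DIM('a) = \<mu> - (real DIM('a) + 2 * s)"
      "- (2 * s - \<theta>) - real DIM('a) = \<theta> - (real DIM('a) + 2 * s)" by simp_all
    then show ?thesis
      by (simp only: powr_diff) (simp add: powr_majorant_def add_divide_distrib)
  qed
  then show ?thesis
    using assms integrable_norm_powr_ball[of "\<mu> - 2 * s", where 'a = 'a]
      integrable_norm_powr_outside_ball[of "2 * s - \<theta>", where 'a = 'a]
    by (simp add: Bochner_Integration.integrable_add)
qed

text \<open>The indicator removes the unspecified value at 0, so that measurability on the punctured
  space extends to the whole space.\<close>

lemma kernel_measurable:
  assumes "K \<in> kernels s lam Lam"
  shows "(\<lambda>z::'a::euclidean_space. indicator (- {0}) z * K z) \<in> borel_measurable lebesgue"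
proof -
  have "K \<in> borel_measurable (lebesgue_on (- {0}))" using assms by (simp add: kernels_def)
  moreover have "- {0::'a} \<inter> space lebesgue \<in> sets lebesgue" by simp
  ultimately show ?thesis by (subst (asm) borel_measurable_restrict_space_iff) simp_all
qed

lemma integrable_times_kernel:
  fixes w :: "'a::euclidean_space \<Rightarrow> real"
  assumes K: "K \<in> kernels s lam Lam" "0 \<le> lam"
    and w: "w \<in> borel_measurable borel" "w 0 = 0"
    and P: "\<And>z. z \<noteq> 0 \<Longrightarrow> \<bar>w z\<bar> \<le> P z"
      "integrable lebesgue (\<lambda>z::'a. P z / norm z powr (real DIM('a) + 2 * s))"
  shows "integrable lebesgue (\<lambda>z. w z * K z)"
proof (rule Bochner_Integration.integrable_bound[OF integrable_mult_right[OF P(2)]])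
  have "(\<lambda>z. w z * K z) = (\<lambda>z. w z * (indicator (- {0}) z * K z))"
    using w(2) by (auto simp: indicator_def)
  then show "(\<lambda>z. w z * K z) \<in> borel_measurable lebesgue"
    using borel_measurable_times[OF borel_measurable_lebesgueI[OF w(1)] kernel_measurable[OF K(1)]]
    by (simp only:)
  have "norm (w z * K z) \<le> norm (Lam * (P z / norm z powr (real DIM('a) + 2 * s)))" for z
  proof (cases "z = 0")
    case False
    then have Kz: "lam / norm z powr (real DIM('a) + 2 * s) \<le> K z"
       "K z \<le> Lam / norm z powr (real DIM('a) + 2 * s)"
      using K by (auto simp: kernels_def)
    have "0 \<le> lam / norm z powr (real DIM('a) + 2 * s)" using K(2) by simp
    then have "0 \<le> K z" using Kz by linarith
    then have "norm (w z * K z) = \<bar>w z\<bar> * K z" by (simp add: abs_mult)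
    also have "\<dots> \<le> P z * (Lam / norm z powr (real DIM('a) + 2 * s))"
      using P(1)[OF False] order_trans[OF abs_ge_zero P(1)[OF False]] Kz(2) \<open>0 \<le> K z\<close>
      by (intro mult_mono)
    also have "\<dots> = Lam * (P z / norm z powr (real DIM('a) + 2 * s))" by simp
    also have "\<dots> \<le> norm (Lam * (P z / norm z powr (real DIM('a) + 2 * s)))"
      by (simp only: real_norm_def abs_ge_self)
    finally show ?thesis .
  qed (simp add: w(2))
  then show "AE z in lebesgue. norm (w z * K z) \<le> norm (Lam * (P z / norm z powr (real DIM('a) + 2 * s)))"
    by simp
qed

text \<open>Without integrability the Bochner integrals in \<open>lin_op\<close> would default to 0
  and could not be merged into one. Increments are controlled by Taylor expansion near 0, by the
  growth \<gamma> < 2s at infinity, and crudely in between.\<close>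

lemma integrable_lin_op:
  fixes U :: "'a::euclidean_space \<Rightarrow> real"
  assumes s: "0 < s" "s < 1" and K: "K \<in> kernels s lam Lam" "0 \<le> lam"
    and U: "U \<in> borel_measurable borel" "U \<in> C11_at 0"
    and g: "\<And>y. \<bar>U y\<bar> \<le> M * (1 + norm y) powr \<gamma>" "0 \<le> \<gamma>" "\<gamma> < 2 * s"
  shows "integrable lebesgue (\<lambda>z. (U (0 + z) - U 0
        - of_bool (2 * s \<in> {1..<2}) * indicator (ball 0 1) z * (grad U 0 \<bullet> z)) * K z)"
proof -
  \<comment> \<open>Local order of the increment: quadratic with the gradient correction, linear
    without it. Both exceed 2s in their case.\<close>
  define \<mu> :: real where "\<mu> = (if 1 \<le> 2 * s then 2 else 1)"
  define p where "p = grad U 0"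
  define c where "c = (of_bool (2 * s \<in> {1..<2}) :: real)"
  have c: "c = (if 1 \<le> 2 * s then 1 else 0)" using s by (simp add: c_def)
  define w where "w z = U (0 + z) - U 0 - c * indicator (ball 0 1) z * (p \<bullet> z)" for z
  obtain C \<delta> where \<delta>: "0 < \<delta>" "0 \<le> C"
    and b: "\<And>z. z \<in> ball 0 \<delta> \<Longrightarrow> \<bar>U z - U 0 - p \<bullet> z\<bar> \<le> C * (norm z)\<^sup>2"
    by (rule C11_at_GDERIV[OF U(2)]) (auto simp: p_def)
  define d where "d = min \<delta> 1"
  have d: "0 < d" "d \<le> 1" using \<delta> by (auto simp: d_def)
  have M0: "0 \<le> M" "\<bar>U 0\<bar> \<le> M" using g(1)[of 0] by simp_all
  \<comment> \<open>One constant for the three regions |z| < d, d <= |z| < 1 and |z| >= 1. The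
    summand for the middle region carries d^(-\<mu>), since |z|^\<mu> >= d^\<mu> there.\<close>
  define A where "A = C + norm p + (M * 2 powr \<gamma> + M + norm p) * d powr - \<mu> + M * 2 powr \<gamma> + M"
  have bound: "\<bar>w z\<bar> \<le> A * powr_majorant \<mu> \<gamma> z" for z
  proof (cases "norm z < 1")
    case True
    have pz: "\<bar>p \<bullet> z\<bar> \<le> norm p * norm z" by (rule Cauchy_Schwarz_ineq2)
    have "\<bar>w z\<bar> \<le> A * norm z powr \<mu>"
    proof (cases "norm z < d")
      case zd: True
      then have bz: "\<bar>U z - U 0 - p \<bullet> z\<bar> \<le> C * (norm z)\<^sup>2" by (intro b) (auto simp: d_def)
      have "\<bar>w z\<bar> \<le> (C + norm p) * norm z powr \<mu>"
      proof (cases "1 \<le> 2 * s")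
        case s1: True
        then have "\<bar>w z\<bar> \<le> C * (norm z)\<^sup>2" using bz True by (simp add: w_def c)
        also have "\<dots> \<le> (C + norm p) * (norm z)\<^sup>2" by (intro mult_right_mono) auto
        finally show ?thesis using s1 by (simp add: \<mu>_def)
      next
        case s1: False
        then have "\<bar>w z\<bar> \<le> C * (norm z)\<^sup>2 + norm p * norm z" using bz pz True by (simp add: w_def c)
        also have "C * (norm z)\<^sup>2 \<le> C * norm z" using True \<delta>
          by (intro mult_left_mono) (auto simp: power2_eq_square mult_left_le)
        finally show ?thesis using s1 by (simp add: \<mu>_def algebra_simps)
      qed
      also have "\<dots> \<le> A * norm z powr \<mu>"
        using M0 unfolding A_def by (intro mult_right_mono) (auto simp: add.assoc)
      finally show ?thesis .
    next
      case zd: False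
      have "\<bar>U z\<bar> \<le> M * (1 + norm z) powr \<gamma>" by (rule g)
      also have "\<dots> \<le> M * 2 powr \<gamma>" using M0 True g by (intro mult_left_mono powr_mono2) auto
      finally have Uz: "\<bar>U z\<bar> \<le> M * 2 powr \<gamma>" .
      have "norm p * norm z \<le> norm p" using True by (simp add: mult_left_le)
      then have "\<bar>c * indicator (ball 0 1) z * (p \<bullet> z)\<bar> \<le> norm p"
        using pz by (auto simp: c indicator_def)
      then have "\<bar>w z\<bar> \<le> M * 2 powr \<gamma> + M + norm p"
        using Uz M0 unfolding w_def by simp
      also have "\<dots> \<le> (M * 2 powr \<gamma> + M + norm p) * (d powr - \<mu> * norm z powr \<mu>)"
      proof -
        have "1 = d powr - \<mu> * d powr \<mu>" using d by (simp flip: powr_add)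
        also have "\<dots> \<le> d powr - \<mu> * norm z powr \<mu>"
          using d zd by (intro mult_left_mono powr_mono2) (auto simp: \<mu>_def)
        finally have "1 \<le> d powr - \<mu> * norm z powr \<mu>" .
        moreover have "0 \<le> M * 2 powr \<gamma> + M + norm p" using M0 by simp
        ultimately show ?thesis by (metis mult.right_neutral mult_left_mono)
      qed
      also have "\<dots> = ((M * 2 powr \<gamma> + M + norm p) * d powr - \<mu>) * norm z powr \<mu>" by simp
      also have "\<dots> \<le> A * norm z powr \<mu>"
        using M0 \<delta> unfolding A_def by (intro mult_right_mono) auto
      finally show ?thesis .
    qed
    then show ?thesis using True by (simp add: powr_majorant_def)
  next
    case False
    have "\<bar>U z\<bar> \<le> M * (1 + norm z) powr \<gamma>" by (rule g)
    also have "\<dots> \<le> M * (2 * norm z) powr \<gamma>" using M0 False g by (intro mult_left_mono powr_mono2) auto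
    also have "\<dots> = M * 2 powr \<gamma> * norm z powr \<gamma>" by (simp add: powr_mult)
    finally have Uz: "\<bar>U z\<bar> \<le> M * 2 powr \<gamma> * norm z powr \<gamma>" .
    have "1 \<le> norm z powr \<gamma>" using False g by (intro ge_one_powr_ge_zero) auto
    from mult_left_mono[OF this M0(1)] have "\<bar>U 0\<bar> \<le> M * norm z powr \<gamma>" using M0 by simp
    then have "\<bar>w z\<bar> \<le> (M * 2 powr \<gamma> + M) * norm z powr \<gamma>"
      using Uz False by (simp add: w_def algebra_simps)
    also have "\<dots> \<le> A * norm z powr \<gamma>"
      using M0 \<delta> unfolding A_def by (intro mult_right_mono) auto
    finally show ?thesis using False by (simp add: powr_majorant_def)
  qed
  have "integrable lebesgue (\<lambda>z. w z * K z)"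
  proof (rule integrable_times_kernel[OF K, where P = "\<lambda>z. A * powr_majorant \<mu> \<gamma> z"])
    have "(\<lambda>z. p \<bullet> z) \<in> borel_measurable borel"
      by (intro borel_measurable_continuous_onI continuous_intros)
    then show "w \<in> borel_measurable borel"
      unfolding w_def[abs_def] add_0 using U(1)
      by (intro borel_measurable_diff borel_measurable_times borel_measurable_indicator borel_measurable_const)
        auto
    show "w 0 = 0" by (simp add: w_def)
    show "integrable lebesgue (\<lambda>z::'a. A * powr_majorant \<mu> \<gamma> z / norm z powr (real DIM('a) + 2 * s))"
      using integrable_mult_right[OF integrable_powr_majorant[of s \<mu> \<gamma>, where 'a = 'a], of A] s g
      by (simp add: \<mu>_def split: if_splits)
  qed (rule bound)
  then show ?thesis by (simp add: w_def c_def p_def)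
qed

text \<open>The weight 1 + |.| is submultiplicative under addition: 1 + |y + x| <= (1 + |x|) (1 +
  |y|).\<close>

lemma growth_translate:
  fixes v :: "'a::real_normed_vector \<Rightarrow> real"
  assumes "\<And>y. \<bar>v y\<bar> \<le> M * (1 + norm y) powr \<gamma>" "0 \<le> \<gamma>"
  shows "\<bar>v (y + x)\<bar> \<le> M * (1 + norm x) powr \<gamma> * (1 + norm y) powr \<gamma>"
proof -
  have M0: "0 \<le> M" using assms(1)[of 0] by simp
  have "1 + norm (y + x) \<le> (1 + norm x) * (1 + norm y)"
    using norm_triangle_ineq[of y x] mult_nonneg_nonneg[OF norm_ge_zero[of x] norm_ge_zero[of y]]
    unfolding distrib_left distrib_right by linarith
  then have "(1 + norm (y + x)) powr \<gamma> \<le> ((1 + norm x) * (1 + norm y)) powr \<gamma>"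
    using assms by (intro powr_mono2) auto
  then have "M * (1 + norm (y + x)) powr \<gamma> \<le> M * ((1 + norm x) powr \<gamma> * (1 + norm y) powr \<gamma>)"
    using M0 by (simp add: powr_mult mult_left_mono)
  then show ?thesis using assms(1)[of "y + x"] by simp
qed

text \<open>Translation invariance moves both points to the origin, where \<open>elliptic\<close>
  compares. For each kernel, \<open>P\<close> is weighed by at most Lam and the gain
  \<open>Q\<close> by at least lam; the resulting bound is independent of the kernel and so survives
  the supremum.\<close>

lemma elliptic_upper_bound:
  fixes v1 v2 :: "'a::euclidean_space \<Rightarrow> real" and I :: "('a \<Rightarrow> real) \<Rightarrow> 'a \<Rightarrow> real"
  assumes s: "0 < s" "s < 1" and lam: "0 < lam" "lam \<le> Lam"
    and I: "translation_invariant s I" "elliptic s lam Lam I"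
    and \<gamma>: "0 \<le> \<gamma>" "\<gamma> < 2 * s"
    and v1: "v1 \<in> borel_measurable borel" "v1 \<in> C11_at x" "\<And>y. \<bar>v1 y\<bar> \<le> M1 * (1 + norm y) powr \<gamma>"
    and v2: "v2 \<in> borel_measurable borel" "v2 \<in> C11_at y" "\<And>y. \<bar>v2 y\<bar> \<le> M2 * (1 + norm y) powr \<gamma>"
    and P: "\<And>z. 0 \<le> P z" "integrable lebesgue (\<lambda>z::'a. P z / norm z powr (real DIM('a) + 2 * s))"
    and Q: "\<And>z. 0 \<le> Q z" "integrable lebesgue (\<lambda>z::'a. Q z / norm z powr (real DIM('a) + 2 * s))"
    and w: "\<And>z. z \<noteq> 0 \<Longrightarrow> v1 (x + z) - v1 x - (v2 (y + z) - v2 y)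
        - of_bool (2 * s \<in> {1..<2}) * indicator (ball 0 1) z * ((grad v1 x - grad v2 y) \<bullet> z) \<le> P z - Q z"
  shows "I v1 x - I v2 y \<le> Lam * (LINT z|lebesgue. P z / norm z powr (real DIM('a) + 2 * s))
      - lam * (LINT z|lebesgue. Q z / norm z powr (real DIM('a) + 2 * s))"
proof -
  define U where "U y = v1 (y + x)" for y
  define V where "V z = v2 (z + y)" for z
  have L1: "v1 \<in> weighted_L1 s" "v2 \<in> weighted_L1 s"
    using growth_imp_weighted_L1 v1 v2 \<gamma> by blast+
  have growth: "\<bar>U z\<bar> \<le> M1 * (1 + norm x) powr \<gamma> * (1 + norm z) powr \<gamma>"
    "\<bar>V z\<bar> \<le> M2 * (1 + norm y) powr \<gamma> * (1 + norm z) powr \<gamma>" for z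
    unfolding U_def V_def using v1(3) v2(3) \<gamma>(1) by (blast intro: growth_translate)+
  have mU: "U \<in> borel_measurable borel"
    unfolding U_def by (rule measurable_compose[OF _ v1(1)]) simp
  have mV: "V \<in> borel_measurable borel"
    unfolding V_def by (rule measurable_compose[OF _ v2(1)]) simp
  have C: "U \<in> C11_at 0" "V \<in> C11_at 0"
    using C11_at_translate[of v1 0 x] C11_at_translate[of v2 0 y] v1 v2 by (simp_all add: U_def[abs_def] V_def[abs_def])
  have UV: "U \<in> C11_at 0 \<inter> weighted_L1 s" "V \<in> C11_at 0 \<inter> weighted_L1 s"
    using growth_imp_weighted_L1[OF mU \<gamma>(2) growth(1)] growth_imp_weighted_L1[OF mV \<gamma>(2) growth(2)] C
    by blast+
  have gU: "grad U 0 = grad v1 x"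
    using C11_at_GDERIV[OF v1(2)] GDERIV_translate[of v1 0 x] unfolding U_def[abs_def]
    by (metis add_0 grad_eqI)
  have gV: "grad V 0 = grad v2 y"
    using C11_at_GDERIV[OF v2(2)] GDERIV_translate[of v2 0 y] unfolding V_def[abs_def]
    by (metis add_0 grad_eqI)
  have IU: "I U 0 = I v1 x" "I V 0 = I v2 y"
    using I(1) v1 v2 L1 unfolding translation_invariant_def U_def[abs_def] V_def[abs_def] by simp_all
  \<comment> \<open>Witnessed by the smallest kernel. The supremum of an empty set of reals has no
    usable value, so nonemptiness has to be shown.\<close>
  have ne: "(kernels s lam Lam :: ('a \<Rightarrow> real) set) \<noteq> {}"
  proof -
    have "(\<lambda>z::'a. lam / norm z powr (real DIM('a) + 2 * s)) \<in> borel_measurable (lebesgue_on (- {0}))"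
      by (intro measurable_restrict_space1 borel_measurable_lebesgueI borel_measurable_divide
          borel_measurable_norm_powr borel_measurable_const)
    then have "(\<lambda>z::'a. lam / norm z powr (real DIM('a) + 2 * s)) \<in> kernels s lam Lam"
      using lam unfolding kernels_def by (auto intro!: divide_right_mono)
    then show ?thesis by blast
  qed
  have "I v1 x - I v2 y \<le> (SUP K\<in>kernels s lam Lam. lin_op s K U 0 - lin_op s K V 0)"
    using I(2) UV unfolding elliptic_def IU[symmetric] by blast
  also have "\<dots> \<le> Lam * (LINT z|lebesgue. P z / norm z powr (real DIM('a) + 2 * s))
      - lam * (LINT z|lebesgue. Q z / norm z powr (real DIM('a) + 2 * s))"
  proof (rule cSUP_least[OF ne])
    fix K :: "'a \<Rightarrow> real" assume K: "K \<in> kernels s lam Lam"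
    let ?c = "\<lambda>z::'a. of_bool (2 * s \<in> {1..<2}) * indicator (ball 0 1) z :: real"
    let ?N = "\<lambda>z::'a. norm z powr (real DIM('a) + 2 * s)"
    have int: "integrable lebesgue (\<lambda>z. (U (0 + z) - U 0 - ?c z * (grad U 0 \<bullet> z)) * K z)"
      "integrable lebesgue (\<lambda>z. (V (0 + z) - V 0 - ?c z * (grad V 0 \<bullet> z)) * K z)"
      using integrable_lin_op[OF s K _ mU C(1) growth(1) \<gamma>] integrable_lin_op[OF s K _ mV C(2) growth(2) \<gamma>] lam
      by auto
    have "lin_op s K U 0 - lin_op s K V 0 = (LINT z|lebesgue.
      (U (0 + z) - U 0 - ?c z * (grad U 0 \<bullet> z)) * K z - (V (0 + z) - V 0 - ?c z * (grad V 0 \<bullet> z)) * K z)"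
      unfolding lin_op_def using int by (rule Bochner_Integration.integral_diff[symmetric])
    also have "\<dots> \<le> (LINT z|lebesgue. Lam * (P z / ?N z) - lam * (Q z / ?N z))"
    proof (rule integral_mono[OF Bochner_Integration.integrable_diff[OF int]
          Bochner_Integration.integrable_diff[OF integrable_mult_right[OF P(2)] integrable_mult_right[OF Q(2)]]])
      fix z
      show "(U (0 + z) - U 0 - ?c z * (grad U 0 \<bullet> z)) * K z - (V (0 + z) - V 0 - ?c z * (grad V 0 \<bullet> z)) * K z
          \<le> Lam * (P z / ?N z) - lam * (Q z / ?N z)"
      proof (cases "z = 0")
        case False
        then have Kz: "lam / ?N z \<le> K z" "K z \<le> Lam / ?N z"
          using K by (auto simp: kernels_def)
        have "0 \<le> lam / ?N z" using lam by simp
        then have K0: "0 \<le> K z" using Kz by linarith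
        have "U (0 + z) - U 0 - ?c z * (grad U 0 \<bullet> z) - (V (0 + z) - V 0 - ?c z * (grad V 0 \<bullet> z)) \<le> P z - Q z"
          using w[OF False] unfolding gU gV by (simp add: U_def V_def inner_diff_left algebra_simps)
        from mult_right_mono[OF this K0]
        have "(U (0 + z) - U 0 - ?c z * (grad U 0 \<bullet> z)) * K z - (V (0 + z) - V 0 - ?c z * (grad V 0 \<bullet> z)) * K z
          \<le> P z * K z - Q z * K z" by (simp add: left_diff_distrib)
        moreover have "P z * K z \<le> P z * (Lam / ?N z)" "Q z * (lam / ?N z) \<le> Q z * K z"
          by (rule mult_left_mono[OF Kz(2) P(1)], rule mult_left_mono[OF Kz(1) Q(1)])
        ultimately show ?thesis by (simp add: mult.commute)
      qed simp
    qed
    also have "\<dots> = Lam * (LINT z|lebesgue. P z / ?N z) - lam * (LINT z|lebesgue. Q z / ?N z)"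
      by (subst Bochner_Integration.integral_diff[OF integrable_mult_right[OF P(2)] integrable_mult_right[OF Q(2)]])
        (simp only: integral_mult_right_zero)
    finally show "lin_op s K U 0 - lin_op s K V 0
      \<le> Lam * (LINT z|lebesgue. P z / ?N z) - lam * (LINT z|lebesgue. Q z / ?N z)" .
  qed
  finally show ?thesis .
qed

section \<open>The penalty at infinity\<close>

text \<open>After division by (a + b)^\<theta> both terms are powers of fractions in [0, 1], where t
  <= t^\<theta>.\<close>

lemma powr_add_le:
  fixes a b \<theta> :: real
  assumes "0 \<le> a" "0 \<le> b" "0 < \<theta>" "\<theta> \<le> 1"
  shows "(a + b) powr \<theta> \<le> a powr \<theta> + b powr \<theta>"
proof (cases "a + b = 0")
  case False
  then have ab: "0 < a + b" using assms by simp
  have le: "t / (a + b) \<le> (t / (a + b)) powr \<theta>" if "0 \<le> t" "t \<le> a + b" for t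
    using powr_mono'[of \<theta> 1 "t / (a + b)"] that ab assms by (simp add: divide_le_eq_1)
  have "1 = a / (a + b) + b / (a + b)" using ab by (simp add: add_divide_distrib[symmetric])
  also have "\<dots> \<le> (a / (a + b)) powr \<theta> + (b / (a + b)) powr \<theta>"
    using assms by (intro add_mono le) auto
  also have "\<dots> = (a powr \<theta> + b powr \<theta>) / (a + b) powr \<theta>"
    by (simp add: powr_divide add_divide_distrib)
  finally show ?thesis using ab by (simp add: le_divide_eq)
qed (use assms in auto)

text \<open>A smooth replacement for |x|^\<theta>, with the same growth at infinity and no
  singularity at 0.\<close>

definition bracket :: "real \<Rightarrow> 'a::euclidean_space \<Rightarrow> real" where
  "bracket \<theta> x = (1 + (norm x)\<^sup>2) powr (\<theta> / 2)"

definition grad_bracket :: "real \<Rightarrow> 'a::euclidean_space \<Rightarrow> 'a" where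
  "grad_bracket \<theta> x = (\<theta> * (1 + (norm x)\<^sup>2) powr (\<theta> / 2 - 1)) *\<^sub>R x"

lemma one_plus_norm2_pos: "0 < 1 + (norm x)\<^sup>2"
  by (simp add: add_pos_nonneg)

lemma bracket_pos: "0 < bracket \<theta> x"
  using one_plus_norm2_pos[of x] by (simp add: bracket_def)

lemma GDERIV_bracket: "GDERIV (bracket \<theta>) x :> grad_bracket \<theta> x"
proof -
  have "((\<lambda>t. t powr (\<theta> / 2)) has_real_derivative \<theta> / 2 * (1 + (norm x)\<^sup>2) powr (\<theta> / 2 - 1))
      (at (1 + (norm (x - 0))\<^sup>2))"
    using one_plus_norm2_pos[of x] by (auto intro!: derivative_eq_intros simp: powr_diff)
  from GDERIV_comp_sqnorm[OF this] show ?thesis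
    by (simp add: bracket_def[abs_def] grad_bracket_def)
qed

lemma C2_on_bracket: "C2_on S (bracket \<theta> :: 'a::euclidean_space \<Rightarrow> real)"
proof -
  have "C2_on S (\<lambda>x::'a. (1 + (norm (x - 0))\<^sup>2) powr (\<theta> / 2))"
  proof (rule C2_on_comp_sqnorm[where T = "{0<..}" and ?F1.0 = "\<lambda>t. (\<theta> / 2) * t powr (\<theta> / 2 - 1)"
        and ?F2.0 = "\<lambda>t. (\<theta> / 2) * ((\<theta> / 2 - 1) * t powr (\<theta> / 2 - 1 - 1))"])
    show "continuous_on {0<..} (\<lambda>t::real. (\<theta> / 2) * ((\<theta> / 2 - 1) * t powr (\<theta> / 2 - 1 - 1)))"
      by (intro continuous_intros) auto
    fix t :: real assume t: "t \<in> {0<..}"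
    then show "((\<lambda>t. t powr (\<theta> / 2)) has_real_derivative (\<theta> / 2) * t powr (\<theta> / 2 - 1)) (at t)"
      "((\<lambda>t. (\<theta> / 2) * t powr (\<theta> / 2 - 1)) has_real_derivative
          (\<theta> / 2) * ((\<theta> / 2 - 1) * t powr (\<theta> / 2 - 1 - 1))) (at t)"
      using t by (simp_all only: greaterThan_iff has_real_derivative_powr DERIV_cmult)
  qed (simp add: one_plus_norm2_pos)
  then show ?thesis by (simp add: bracket_def[abs_def])
qed

lemma continuous_on_bracket: "continuous_on S (bracket \<theta> :: 'a::euclidean_space \<Rightarrow> real)"
  by (rule C2_on_imp_continuous_on[OF C2_on_bracket])

lemma powr_mult_norm2_le:
  fixes x :: "'a::euclidean_space"
  shows "(1 + (norm x)\<^sup>2) powr (r - 1) * (norm x)\<^sup>2 \<le> (1 + (norm x)\<^sup>2) powr r"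
proof -
  have "(1 + (norm x)\<^sup>2) powr (r - 1) * (norm x)\<^sup>2 \<le> (1 + (norm x)\<^sup>2) powr (r - 1) * (1 + (norm x)\<^sup>2)"
    by (intro mult_left_mono) auto
  also have "\<dots> = (1 + (norm x)\<^sup>2) powr r"
    using one_plus_norm2_pos[of x] by (simp add: powr_diff)
  finally show ?thesis .
qed

text \<open>With t = 1 + |x|^2 the norm is at most t^((\<theta> - 1)/2), which is at most 1 because
  \<theta> <= 1.\<close>

lemma norm_grad_bracket_le:
  fixes x :: "'a::euclidean_space"
  assumes "0 < \<theta>" "\<theta> \<le> 1"
  shows "norm (grad_bracket \<theta> x) \<le> 1"
proof -
  let ?t = "1 + (norm x)\<^sup>2"
  have "norm x \<le> sqrt ?t" by (rule real_le_rsqrt) simp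
  then have x: "norm x \<le> ?t powr (1/2)" using one_plus_norm2_pos[of x] by (simp add: powr_half_sqrt)
  have "norm (grad_bracket \<theta> x) = \<theta> * ?t powr (\<theta> / 2 - 1) * norm x"
    using assms by (simp add: grad_bracket_def abs_mult)
  also have "\<dots> \<le> 1 * ?t powr (\<theta> / 2 - 1) * ?t powr (1/2)"
    using x assms by (intro mult_mono) auto
  also have "\<dots> = ?t powr ((\<theta> - 1) / 2)"
    by (simp add: diff_divide_distrib flip: powr_add)
  also have "\<dots> \<le> 1"
    using assms powr_mono[of "(\<theta> - 1) / 2" 0 ?t] by (simp split: if_splits)
  finally show ?thesis .
qed

lemma bracket_lipschitz:
  fixes x :: "'a::euclidean_space"
  assumes "0 < \<theta>" "\<theta> \<le> 1"
  shows "\<bar>bracket \<theta> y - bracket \<theta> x\<bar> \<le> norm (y - x)"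
proof -
  have "norm (bracket \<theta> y - bracket \<theta> x) \<le> 1 * norm (y - x)"
  proof (rule differentiable_bound[where S = UNIV and f' = "\<lambda>w h. h \<bullet> grad_bracket \<theta> w"])
    fix w :: 'a
    show "(bracket \<theta> has_derivative (\<lambda>h. h \<bullet> grad_bracket \<theta> w)) (at w within UNIV)"
      using GDERIV_bracket[of \<theta> w] unfolding gderiv_def by (rule has_derivative_at_withinI)
    show "onorm (\<lambda>h. h \<bullet> grad_bracket \<theta> w) \<le> 1"
    proof (rule onorm_le)
      fix h :: 'a
      have "norm (h \<bullet> grad_bracket \<theta> w) \<le> norm h * norm (grad_bracket \<theta> w)"
        unfolding real_norm_def by (rule Cauchy_Schwarz_ineq2)
      also have "\<dots> \<le> norm h * 1" using norm_grad_bracket_le[OF assms] by (intro mult_left_mono) auto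
      finally show "norm (h \<bullet> grad_bracket \<theta> w) \<le> 1 * norm h" by simp
    qed
  qed auto
  then show ?thesis by simp
qed

text \<open>The Hessian is a multiple of the identity of norm at most 1 plus a rank-one term of norm
  at most |\<theta> (\<theta> - 2)| <= 2, hence the constant 3.\<close>

lemma grad_bracket_lipschitz:
  fixes x :: "'a::euclidean_space"
  assumes "0 < \<theta>" "\<theta> \<le> 1"
  shows "norm (grad_bracket \<theta> y - grad_bracket \<theta> x) \<le> 3 * norm (y - x)"
proof (rule differentiable_bound[where S = UNIV and f' = "\<lambda>w h. (\<theta> * (1 + (norm w)\<^sup>2) powr (\<theta> / 2 - 1)) *\<^sub>R h
    + (h \<bullet> ((2 * (\<theta> * ((\<theta> / 2 - 1) * (1 + (norm w)\<^sup>2) powr (\<theta> / 2 - 1 - 1)))) *\<^sub>R (w - 0))) *\<^sub>R w"])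
  fix w :: 'a
  let ?t = "1 + (norm w)\<^sup>2"
  have "((\<lambda>t. \<theta> * t powr (\<theta> / 2 - 1)) has_real_derivative
      \<theta> * ((\<theta> / 2 - 1) * ?t powr (\<theta> / 2 - 1 - 1))) (at (1 + (norm (w - 0))\<^sup>2))"
    using one_plus_norm2_pos[of w] by (simp only: diff_zero has_real_derivative_powr DERIV_cmult)
  from GDERIV_comp_sqnorm[OF this]
  have 1: "((\<lambda>w. \<theta> * (1 + (norm w)\<^sup>2) powr (\<theta> / 2 - 1)) has_derivative
     (\<lambda>h. h \<bullet> ((2 * (\<theta> * ((\<theta> / 2 - 1) * ?t powr (\<theta> / 2 - 1 - 1)))) *\<^sub>R (w - 0)))) (at w)"
    unfolding gderiv_def diff_zero .
  show "(grad_bracket \<theta> has_derivative (\<lambda>h. (\<theta> * ?t powr (\<theta> / 2 - 1)) *\<^sub>R h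
    + (h \<bullet> ((2 * (\<theta> * ((\<theta> / 2 - 1) * ?t powr (\<theta> / 2 - 1 - 1)))) *\<^sub>R (w - 0))) *\<^sub>R w)) (at w within UNIV)"
    unfolding grad_bracket_def[abs_def]
    by (rule has_derivative_scaleR[OF 1 has_derivative_ident])
  show "onorm (\<lambda>h. (\<theta> * ?t powr (\<theta> / 2 - 1)) *\<^sub>R h
    + (h \<bullet> ((2 * (\<theta> * ((\<theta> / 2 - 1) * ?t powr (\<theta> / 2 - 1 - 1)))) *\<^sub>R (w - 0))) *\<^sub>R w) \<le> 3"
  proof (rule onorm_le)
    fix h :: 'a
    define A where "A = ?t powr (\<theta> / 2 - 1)"
    define B where "B = ?t powr (\<theta> / 2 - 1 - 1)"
    have A: "0 \<le> A" "A \<le> 1"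
      using assms powr_mono[of "\<theta> / 2 - 1" 0 ?t] one_plus_norm2_pos[of w] by (auto simp: A_def)
    have B: "0 \<le> B" "B * (norm w)\<^sup>2 \<le> A"
      unfolding A_def B_def using powr_mult_norm2_le[of w "\<theta> / 2 - 1"] by simp_all
    have "\<theta> * A \<le> 1" using A assms by (simp add: mult_le_one)
    then have n1: "norm ((\<theta> * A) *\<^sub>R h) \<le> norm h"
      using A assms by (simp add: mult_left_le_one_le)
    have th: "\<bar>\<theta> * (\<theta> - 2)\<bar> \<le> 2"
    proof -
      have "\<bar>\<theta>\<bar> * \<bar>\<theta> - 2\<bar> \<le> 1 * 2" using assms by (intro mult_mono) auto
      then show ?thesis by (simp add: abs_mult)
    qed
    have e: "(h \<bullet> ((2 * (\<theta> * ((\<theta> / 2 - 1) * B))) *\<^sub>R (w - 0))) *\<^sub>R w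
        = (\<theta> * (\<theta> - 2) * (B * (h \<bullet> w))) *\<^sub>R w"
      by (simp add: algebra_simps)
    have "norm ((h \<bullet> ((2 * (\<theta> * ((\<theta> / 2 - 1) * B))) *\<^sub>R (w - 0))) *\<^sub>R w)
        = \<bar>\<theta> * (\<theta> - 2)\<bar> * (B * (\<bar>h \<bullet> w\<bar> * norm w))"
      unfolding e by (simp only: norm_scaleR abs_mult abs_of_nonneg[OF B(1)] mult.assoc)
    also have "\<dots> \<le> 2 * (B * ((norm h * norm w) * norm w))"
      using th B Cauchy_Schwarz_ineq2[of h w] by (intro mult_mono mult_nonneg_nonneg) auto
    also have "\<dots> = 2 * (B * (norm w)\<^sup>2) * norm h" by (simp add: power2_eq_square)
    also have "\<dots> \<le> 2 * 1 * norm h" using A B by (intro mult_right_mono mult_left_mono) auto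
    finally have n2: "norm ((h \<bullet> ((2 * (\<theta> * ((\<theta> / 2 - 1) * B))) *\<^sub>R (w - 0))) *\<^sub>R w) \<le> 2 * norm h" by simp
    show "norm ((\<theta> * ?t powr (\<theta> / 2 - 1)) *\<^sub>R h
       + (h \<bullet> ((2 * (\<theta> * ((\<theta> / 2 - 1) * ?t powr (\<theta> / 2 - 1 - 1)))) *\<^sub>R (w - 0))) *\<^sub>R w) \<le> 3 * norm h"
      using norm_triangle_le[OF add_mono[OF n1 n2]] unfolding A_def B_def by simp
  qed
qed auto

lemma bracket_taylor:
  fixes x :: "'a::euclidean_space"
  assumes "0 < \<theta>" "\<theta> \<le> 1"
  shows "\<bar>bracket \<theta> (x + z) - bracket \<theta> x - grad_bracket \<theta> x \<bullet> z\<bar> \<le> 3 * (norm z)\<^sup>2"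
  using taylor2_bound[of x "norm z" "bracket \<theta>" "grad_bracket \<theta>" 3 "x + z",
      OF GDERIV_bracket grad_bracket_lipschitz[OF assms]] by (simp add: dist_norm)

lemma bracket_eq_sqrt: "bracket \<theta> x = sqrt (1 + (norm x)\<^sup>2) powr \<theta>"
  using one_plus_norm2_pos[of x] by (simp add: bracket_def powr_half_sqrt[symmetric] powr_powr)

text \<open>\<open>bracket\<close> is the \<theta>-th power of the norm of the pair (1, x): the
  triangle inequality for pairs is followed by subadditivity of the power.\<close>

lemma bracket_holder:
  fixes x :: "'a::euclidean_space"
  assumes "0 < \<theta>" "\<theta> \<le> 1"
  shows "\<bar>bracket \<theta> (x + z) - bracket \<theta> x\<bar> \<le> norm z powr \<theta>"
proof -
  have le: "bracket \<theta> (w + v) \<le> bracket \<theta> w + norm v powr \<theta>" for w v :: 'a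
  proof -
    have "sqrt (1 + (norm (w + v))\<^sup>2) \<le> sqrt (1 + (norm w)\<^sup>2) + norm v"
      using norm_triangle_ineq[of "(1::real, w)" "(0::real, v)"] by (simp add: norm_Pair)
    then have "sqrt (1 + (norm (w + v))\<^sup>2) powr \<theta> \<le> (sqrt (1 + (norm w)\<^sup>2) + norm v) powr \<theta>"
      using assms by (intro powr_mono2) auto
    also have "\<dots> \<le> sqrt (1 + (norm w)\<^sup>2) powr \<theta> + norm v powr \<theta>"
      using assms by (intro powr_add_le) auto
    finally show ?thesis unfolding bracket_eq_sqrt .
  qed
  from le[of x z] le[of "x + z" "- z"] show ?thesis by simp
qed

text \<open>Coercivity: the penalty outweighs the growth \<gamma> < \<theta> of \<open>u\<close> and
  thereby confines the maximum points.\<close>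

lemma bracket_sum_ge:
  fixes x y :: "'a::euclidean_space"
  assumes "0 < \<theta>" "\<theta> \<le> 1"
  shows "(1 + norm x + norm y) powr \<theta> \<le> 2 * (bracket \<theta> x + bracket \<theta> y)"
proof -
  have le: "1 + norm w \<le> 2 * sqrt (1 + (norm w)\<^sup>2)" for w :: 'a
  proof -
    have "1 \<le> sqrt (1 + (norm w)\<^sup>2)" "norm w \<le> sqrt (1 + (norm w)\<^sup>2)"
      by (auto intro: real_le_rsqrt)
    then show ?thesis by linarith
  qed
  have "(1 + norm x + norm y) powr \<theta> \<le> (2 * (sqrt (1 + (norm x)\<^sup>2) + sqrt (1 + (norm y)\<^sup>2))) powr \<theta>"
    using le[of x] le[of y] assms by (intro powr_mono2) auto
  also have "\<dots> = 2 powr \<theta> * (sqrt (1 + (norm x)\<^sup>2) + sqrt (1 + (norm y)\<^sup>2)) powr \<theta>"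
    by (simp only: powr_mult)
  also have "\<dots> \<le> 2 * (bracket \<theta> x + bracket \<theta> y)"
  proof (rule mult_mono)
    show "2 powr \<theta> \<le> 2" using powr_mono[of \<theta> 1 2] assms by simp
    show "(sqrt (1 + (norm x)\<^sup>2) + sqrt (1 + (norm y)\<^sup>2)) powr \<theta> \<le> bracket \<theta> x + bracket \<theta> y"
      unfolding bracket_eq_sqrt using assms by (intro powr_add_le) auto
  qed auto
  finally show ?thesis .
qed

text \<open>An exponent above \<open>2 * s\<close> that bounds increments at \<open>z\<close> near \<open>0\<close>: they are \<open>O(|z|\<^sup>2)\<close> with the gradient
  correction of \<^const>\<open>lin_op\<close> and only \<open>O(|z|)\<close> without it.\<close>

definition order_exponent :: "real \<Rightarrow> real" where
  "order_exponent s = (if 1 \<le> 2 * s then 1 + s else 1)"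

text \<open>Exceeding 2s gives integrability near 0. The gap below 2 makes r^(2 -
  \<open>order_exponent s\<close>) vanish with r, which later removes the second difference of the
  radial penalty.\<close>

lemma order_exponent_bounds:
  assumes "0 < s" "s < 1"
  shows "2 * s < order_exponent s" "order_exponent s < 2" "1 \<le> order_exponent s"
  using assms by (auto simp: order_exponent_def)

text \<open>Near 0 this is the Taylor or the Lipschitz bound, according to whether the gradient
  correction is present; away from 0 it is the Hoelder bound. It is uniform in x, so it serves at
  both maximum points wherever they are.\<close>

lemma bracket_increment_bound:
  fixes x :: "'a::euclidean_space"
  assumes s: "0 < s" "s < 1" and \<theta>: "0 < \<theta>" "\<theta> \<le> 1"
  shows "\<bar>bracket \<theta> (x + z) - bracket \<theta> x
      - of_bool (2 * s \<in> {1..<2}) * indicator (ball 0 1) z * (grad_bracket \<theta> x \<bullet> z)\<bar>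
    \<le> 3 * powr_majorant (order_exponent s) \<theta> z"
proof (cases "norm z < 1")
  case z: True
  show ?thesis
  proof (cases "1 \<le> 2 * s")
    case True
    have "(norm z)\<^sup>2 = norm z powr 2" by simp
    also have "\<dots> \<le> norm z powr (1 + s)" using s z by (intro powr_mono') auto
    finally show ?thesis
      using True z s bracket_taylor[OF \<theta>, of x z] by (simp add: powr_majorant_def order_exponent_def)
  next
    case False
    then show ?thesis
      using z s bracket_lipschitz[OF \<theta>, of "x + z" x] by (simp add: powr_majorant_def order_exponent_def)
  qed
next
  case False
  have "norm z powr \<theta> \<le> 3 * norm z powr \<theta>" by simp
  with False show ?thesis using bracket_holder[OF \<theta>, of x z] by (simp add: powr_majorant_def)
qed

section \<open>The doubling estimate\<close>

text \<open>As \<eta> <= 1/2, points of this ball have norm between |a|/2 and 2|a|: the singularity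
  is avoided and the kernel is at least (2|a|)^(-n-2s). Multiplied by a volume of order
  (\<eta>|a|)^n this leaves |a|^(-2s).\<close>

lemma integral_ball_lower_bound:
  fixes a :: "'a::euclidean_space"
  assumes a: "a \<noteq> 0" and \<eta>: "0 < \<eta>" "\<eta> \<le> 1/2" and s: "0 < s"
  shows "integrable lebesgue (\<lambda>z. indicator (ball a (\<eta> * norm a)) z / norm z powr (real DIM('a) + 2 * s))"
    and "unit_ball_vol (real DIM('a)) * 2 powr - (real DIM('a) + 2 * s) * \<eta> powr real DIM('a) * norm a powr (- 2 * s)
      \<le> (LINT z|lebesgue. indicator (ball a (\<eta> * norm a)) z / norm z powr (real DIM('a) + 2 * s))"
proof -
  define n where "n = real DIM('a)"
  define B where "B = ball a (\<eta> * norm a)"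
  have n: "0 < n" by (simp add: n_def)
  have Bz: "norm a / 2 \<le> norm z \<and> norm z \<le> 2 * norm a" if "z \<in> B" for z
  proof -
    have "\<eta> * norm a \<le> 1 / 2 * norm a" using \<eta> by (intro mult_right_mono) auto
    then have d: "norm (a - z) \<le> norm a / 2" using that by (simp add: B_def dist_norm)
    have "norm a - norm z \<le> norm (a - z)" by (rule norm_triangle_ineq2)
    moreover have "norm z - norm a \<le> norm (a - z)"
      using norm_triangle_ineq2[of z a] by (simp add: norm_minus_commute)
    ultimately show ?thesis using d by auto
  qed
  have fin: "integrable lebesgue (indicator B :: 'a \<Rightarrow> real)"
    by (intro integrable_real_indicator) (auto simp: B_def emeasure_lborel_ball_finite[unfolded infinity_ennreal_def])
  show int: "integrable lebesgue (\<lambda>z. indicator (ball a (\<eta> * norm a)) z / norm z powr (real DIM('a) + 2 * s))"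
    unfolding n_def[symmetric] B_def[symmetric]
  proof (rule Bochner_Integration.integrable_bound[OF integrable_mult_right[OF fin]])
    show "(\<lambda>z. indicator B z / norm z powr (n + 2 * s)) \<in> borel_measurable lebesgue"
      by (intro borel_measurable_lebesgueI borel_measurable_divide
          borel_measurable_norm_powr borel_measurable_indicator) (simp add: B_def)
    have "norm (indicator B z / norm z powr (n + 2 * s))
        \<le> norm ((norm a / 2) powr - (n + 2 * s) * indicator B z)" for z
    proof (cases "z \<in> B")
      case True
      then have "norm z powr - (n + 2 * s) \<le> (norm a / 2) powr - (n + 2 * s)"
        using Bz[OF True] a n s by (intro powr_mono2') auto
      then show ?thesis using True unfolding powr_minus_divide by simp
    qed simp
    then show "AE z in lebesgue. norm (indicator B z / norm z powr (n + 2 * s))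
        \<le> norm ((norm a / 2) powr - (n + 2 * s) * indicator B z)" by simp
  qed
  have "measure lebesgue B = unit_ball_vol n * (\<eta> * norm a) powr n"
    using a \<eta> by (simp add: B_def n_def content_ball powr_realpow)
  then have "(LINT z|lebesgue. (2 * norm a) powr - (n + 2 * s) * indicator B z)
     = (2 * norm a) powr - (n + 2 * s) * (unit_ball_vol n * (\<eta> * norm a) powr n)"
    by simp
  also have "\<dots> = unit_ball_vol n * 2 powr - (n + 2 * s) * \<eta> powr n * (norm a powr - (n + 2 * s) * norm a powr n)"
    by (simp only: powr_mult mult_ac)
  also have "norm a powr - (n + 2 * s) * norm a powr n = norm a powr (- 2 * s)"
    by (simp flip: powr_add)
  finally have eq: "(LINT z|lebesgue. (2 * norm a) powr - (n + 2 * s) * indicator B z)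
     = unit_ball_vol n * 2 powr - (n + 2 * s) * \<eta> powr n * norm a powr (- 2 * s)" .
  have "(LINT z|lebesgue. (2 * norm a) powr - (n + 2 * s) * indicator B z)
     \<le> (LINT z|lebesgue. indicator B z / norm z powr (n + 2 * s))"
  proof (rule integral_mono[OF integrable_mult_right[OF fin]])
    show "integrable lebesgue (\<lambda>z. indicator B z / norm z powr (n + 2 * s))"
      using int unfolding n_def B_def .
    fix z
    show "(2 * norm a) powr - (n + 2 * s) * indicator B z \<le> indicator B z / norm z powr (n + 2 * s)"
    proof (cases "z \<in> B")
      case True
      have "0 < norm z" using Bz[OF True] a by (auto intro: less_le_trans[of _ "norm a / 2"])
      then have "(2 * norm a) powr - (n + 2 * s) \<le> norm z powr - (n + 2 * s)"
        using Bz[OF True] a n s by (intro powr_mono2') auto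
      then show ?thesis using True unfolding powr_minus_divide by simp
    qed simp
  qed
  then show "unit_ball_vol (real DIM('a)) * 2 powr - (real DIM('a) + 2 * s) * \<eta> powr real DIM('a) * norm a powr (- 2 * s)
      \<le> (LINT z|lebesgue. indicator (ball a (\<eta> * norm a)) z / norm z powr (real DIM('a) + 2 * s))"
    unfolding eq unfolding n_def B_def .
qed

text \<open>The first-order Taylor terms at a + z and a - z cancel.\<close>

lemma second_difference_bound:
  fixes a :: "'a::euclidean_space"
  assumes "C2_on (ball a \<rho>) f" "0 < \<rho>"
  obtains C \<delta> where "0 \<le> C" "0 < \<delta>" "\<delta> < \<rho>"
    "\<And>z. norm z \<le> \<delta> \<Longrightarrow> f (a + z) + f (a - z) - 2 * f a \<le> C * (norm z)\<^sup>2"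
proof -
  obtain C \<delta> where \<delta>: "0 < \<delta>" "\<delta> < \<rho>" "0 \<le> C"
    and b: "\<And>y. y \<in> cball a \<delta> \<Longrightarrow> \<bar>f y - f a - grad f a \<bullet> (y - a)\<bar> \<le> C * (norm (y - a))\<^sup>2"
    by (rule C2_on_ball_taylor[OF assms]) blast
  have "f (a + z) + f (a - z) - 2 * f a \<le> (2 * C) * (norm z)\<^sup>2" if "norm z \<le> \<delta>" for z
    using b[of "a + z"] b[of "a - z"] that by (simp add: dist_norm abs_le_iff)
  with \<delta> that[of "2 * C" \<delta>] show ?thesis by simp
qed

section \<open>Radial penalties and the test functions built from them\<close>

text \<open>\<open>F\<close> is the radial penalty as a function of the squared distance, and \<open>F1\<close> is its derivative.\<close>

definition radial_profile :: "(real \<Rightarrow> real) \<Rightarrow> (real \<Rightarrow> real) \<Rightarrow> bool" where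
  "radial_profile F F1 \<longleftrightarrow>
    continuous_on {0..} F \<and> (\<forall>t t'. 0 \<le> t \<longrightarrow> t \<le> t' \<longrightarrow> F t \<le> F t') \<and>
    (\<exists>F2. continuous_on {0<..} F2 \<and>
      (\<forall>t>0. (F has_real_derivative F1 t) (at t) \<and> (F1 has_real_derivative F2 t) (at t)))"

text \<open>A profile may be singular at t = 0, so smoothness is claimed only off y; continuity at y
  comes from continuity of \<open>F\<close> on the closed half-line.\<close>

lemma
  fixes y :: "'a::euclidean_space"
  assumes F: "radial_profile F F1"
  shows C2_on_radial: "y \<notin> S \<Longrightarrow> C2_on S (\<lambda>x. F ((norm (x - y))\<^sup>2))"
    and GDERIV_radial: "x \<noteq> y \<Longrightarrow> GDERIV (\<lambda>x. F ((norm (x - y))\<^sup>2)) x :> (2 * F1 ((norm (x - y))\<^sup>2)) *\<^sub>R (x - y)"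
    and continuous_on_radial: "continuous_on UNIV (\<lambda>x. F ((norm (x - y))\<^sup>2))"
proof -
  obtain F2 where F2: "continuous_on {0<..} F2"
    "\<And>t. 0 < t \<Longrightarrow> (F has_real_derivative F1 t) (at t)"
    "\<And>t. 0 < t \<Longrightarrow> (F1 has_real_derivative F2 t) (at t)"
    using F unfolding radial_profile_def by blast
  show "C2_on S (\<lambda>x. F ((norm (x - y))\<^sup>2))" if "y \<notin> S"
  proof -
    have "C2_on S (\<lambda>x. F (0 + (norm (x - y))\<^sup>2))"
      by (rule C2_on_comp_sqnorm[where T = "{0<..}"]) (use F2 that in auto)
    then show ?thesis by simp
  qed
  show "GDERIV (\<lambda>x. F ((norm (x - y))\<^sup>2)) x :> (2 * F1 ((norm (x - y))\<^sup>2)) *\<^sub>R (x - y)" if "x \<noteq> y"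
    using GDERIV_comp_sqnorm[of F "F1 (0 + (norm (x - y))\<^sup>2)" 0 x y] F2(2)[of "(norm (x - y))\<^sup>2"] that
    by (simp del: gderiv_deriv)
  have "continuous_on {0..} F" using F by (simp add: radial_profile_def)
  then show "continuous_on UNIV (\<lambda>x. F ((norm (x - y))\<^sup>2))"
    by (rule continuous_on_compose2) (auto intro!: continuous_intros)
qed

text \<open>Makes glued functions admissible in \<open>elliptic_upper_bound\<close>. The test
  function is bounded on the compact ball, so the growth exponent \<gamma> is kept with a larger
  constant.\<close>

lemma glue_properties:
  fixes \<psi> u :: "'a::euclidean_space \<Rightarrow> real"
  assumes r: "0 < r" and \<psi>: "C2_on (ball x r) \<psi>" "continuous_on UNIV \<psi>"
    and u: "continuous_on UNIV u" "\<And>y. \<bar>u y\<bar> \<le> M * (1 + norm y) powr \<gamma>" and \<gamma>: "0 \<le> \<gamma>"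
  shows "glue x r \<psi> u \<in> borel_measurable borel" "glue x r \<psi> u \<in> C11_at x"
    "\<exists>M'. \<forall>y. \<bar>glue x r \<psi> u y\<bar> \<le> M' * (1 + norm y) powr \<gamma>"
    "grad (glue x r \<psi> u) x = grad \<psi> x"
proof -
  show "glue x r \<psi> u \<in> borel_measurable borel"
    unfolding glue_def using \<psi>(2) u(1)
    by (intro measurable_If borel_measurable_continuous_onI) auto
  show "glue x r \<psi> u \<in> C11_at x"
    by (rule C11_at_cong[OF C2_on_imp_C11_at[OF \<psi>(1) r] r]) (simp add: glue_def)
  have "compact (\<psi> ` cball x r)"
    using \<psi>(2) by (intro compact_continuous_image) (auto intro: continuous_on_subset)
  then obtain B where B: "\<And>y. y \<in> cball x r \<Longrightarrow> norm (\<psi> y) \<le> B"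
    by (metis bounded_iff compact_imp_bounded imageI)
  have M0: "0 \<le> M" using u(2)[of 0] by simp
  have "\<bar>glue x r \<psi> u y\<bar> \<le> (M + \<bar>B\<bar>) * (1 + norm y) powr \<gamma>" for y
  proof (cases "y \<in> ball x r")
    case True
    have "1 \<le> (1 + norm y) powr \<gamma>" using \<gamma> by (intro ge_one_powr_ge_zero) auto
    then have "(M + \<bar>B\<bar>) * 1 \<le> (M + \<bar>B\<bar>) * (1 + norm y) powr \<gamma>"
      using M0 by (intro mult_left_mono) auto
    then show ?thesis using True B[of y] M0 by (simp add: glue_def)
  next
    case False
    then show ?thesis using u(2)[of y] by (simp add: glue_def distrib_right add_increasing2)
  qed
  then show "\<exists>M'. \<forall>y. \<bar>glue x r \<psi> u y\<bar> \<le> M' * (1 + norm y) powr \<gamma>" by blast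
  have "GDERIV (glue x r \<psi> u) x :> grad \<psi> x"
    by (rule GDERIV_transform[OF C2_on_GDERIV_grad[OF \<psi>(1)], where S = "ball x r"])
      (use r in \<open>auto simp: glue_def\<close>)
  then show "grad (glue x r \<psi> u) x = grad \<psi> x" by (rule grad_eqI)
qed

text \<open>The increment z falls into one of three regions. For |z| < r the test functions are used
  and the second difference of the penalty is O(|z|^2). For z near a = x - y they are used again and
  give the gain \<open>D\<close>, as |a + z| <= (2 + \<eta>)|a|, |a - z| <= \<eta>|a| and
  \<open>F\<close> is monotone. Elsewhere both points move together. Finally r tends to 0.\<close>

lemma doubling_estimate:
  fixes u :: "'a::euclidean_space \<Rightarrow> real" and I :: "('a \<Rightarrow> real) \<Rightarrow> 'a \<Rightarrow> real" and H :: "'a \<Rightarrow> real"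
  defines "J \<theta> s \<equiv> (LINT z|lebesgue. powr_majorant (order_exponent s) \<theta> (z::'a) / norm z powr (real DIM('a) + 2 * s))"
  assumes s: "0 < s" "s < 1" and lam: "0 < lam" "lam \<le> Lam"
    and I: "translation_invariant s I" "elliptic s lam Lam I"
    and \<gamma>: "0 \<le> \<gamma>" "\<gamma> < \<theta>" and \<theta>: "\<theta> \<le> 1" "\<theta> < 2 * s"
    and u: "visc_subsolution s I (\<lambda>x t p. H p) UNIV u" "visc_supersolution s I (\<lambda>x t p. H p) UNIV u"
      "continuous_on UNIV u" "\<And>x. \<bar>u x\<bar> \<le> M * (1 + norm x) powr \<gamma>"
    and F: "radial_profile F F1" and \<epsilon>: "0 < \<epsilon>"
    and max: "\<And>x' y'. u x' - u y' - F ((norm (x' - y'))\<^sup>2) - \<epsilon> * (bracket \<theta> x' + bracket \<theta> y')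
      \<le> u x - u y - F ((norm (x - y))\<^sup>2) - \<epsilon> * (bracket \<theta> x + bracket \<theta> y)"
    and ne: "x \<noteq> y"
    and \<eta>: "0 < \<eta>" "\<eta> \<le> 1/2"
    and D: "0 \<le> D" "F (((2 + \<eta>) * norm (x - y))\<^sup>2) + F ((\<eta> * norm (x - y))\<^sup>2) - 2 * F ((norm (x - y))\<^sup>2) \<le> - D"
  shows "H ((2 * F1 ((norm (x - y))\<^sup>2)) *\<^sub>R (x - y) + \<epsilon> *\<^sub>R grad_bracket \<theta> x)
      - H ((2 * F1 ((norm (x - y))\<^sup>2)) *\<^sub>R (x - y) - \<epsilon> *\<^sub>R grad_bracket \<theta> y)
      + lam * (D * (unit_ball_vol (real DIM('a)) * 2 powr - (real DIM('a) + 2 * s)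
          * \<eta> powr real DIM('a) * norm (x - y) powr (- 2 * s)))
    \<le> Lam * (6 * \<epsilon> * J \<theta> s)"
proof -
  define n where "n = real DIM('a)"
  define \<mu> where "\<mu> = order_exponent s"
  define a where "a = x - y"
  define N where "N = norm a"
  define p where "p = (2 * F1 (N\<^sup>2)) *\<^sub>R a"
  define m where "m = (powr_majorant \<mu> \<theta> :: 'a \<Rightarrow> real)"
  define c where "c z = (of_bool (2 * s \<in> {1..<2}) * indicator (ball 0 1) z :: real)" for z :: 'a
  define bi where "bi x z = bracket \<theta> (x + z) - bracket \<theta> x - c z * (grad_bracket \<theta> x \<bullet> z)" for x z :: 'a
  define sd where "sd z = F ((norm (a + z))\<^sup>2) + F ((norm (a - z))\<^sup>2) - 2 * F (N\<^sup>2)" for z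
  define vol where "vol = D * (unit_ball_vol n * 2 powr - (n + 2 * s) * \<eta> powr n * N powr (- 2 * s))"
  have \<theta>0: "0 < \<theta>" and \<gamma>s: "\<gamma> < 2 * s" using \<gamma> \<theta> by simp_all
  have N: "0 < N" using ne by (simp add: N_def a_def)
  have mono: "F t \<le> F t'" if "0 \<le> t" "t \<le> t'" for t t' using F that unfolding radial_profile_def by blast
  have bi: "\<bar>bi w z\<bar> \<le> 3 * m z" for w z
    using bracket_increment_bound[OF s \<theta>0 \<theta>(1), of w z] by (simp add: bi_def c_def m_def \<mu>_def)
  have m0: "0 \<le> m z" for z by (simp add: m_def powr_majorant_nonneg)
  have intm: "integrable lebesgue (\<lambda>z. m z / norm z powr (n + 2 * s))"
    unfolding m_def n_def \<mu>_def using order_exponent_bounds[OF s] \<theta> by (intro integrable_powr_majorant) auto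
  \<comment> \<open>The ball of radius \<open>N\<close> about \<open>a\<close> omits the origin, the
    only point where the penalty may fail to be smooth.\<close>
  obtain C \<delta> where C: "0 \<le> C" "0 < \<delta>" "\<delta> < N" and sd_C: "\<And>z. norm z \<le> \<delta> \<Longrightarrow> sd z \<le> C * (norm z)\<^sup>2"
  proof (rule second_difference_bound)
    show "C2_on (ball a N) (\<lambda>x. F ((norm (x - 0))\<^sup>2))"
      by (rule C2_on_radial[OF F]) (simp add: N_def)
  qed (use N in \<open>auto simp: sd_def N_def\<close>)
  \<comment> \<open>Freezing y, respectively x, in \<open>max\<close> yields a function that touches
    u from above at x, respectively from below at y; the additive constants are fixed by
    contact.\<close>
  define \<psi>1 where "\<psi>1 w = F ((norm (w - y))\<^sup>2) + (\<epsilon> * bracket \<theta> w + (u x - F (N\<^sup>2) - \<epsilon> * bracket \<theta> x))" for w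
  define \<psi>2 where "\<psi>2 w = (-1) * F ((norm (w - x))\<^sup>2) + ((- \<epsilon>) * bracket \<theta> w + (u y + F (N\<^sup>2) + \<epsilon> * bracket \<theta> y))" for w
  have \<psi>_at: "\<psi>1 x = u x" "\<psi>2 y = u y"
    by (simp_all add: \<psi>1_def \<psi>2_def N_def a_def norm_minus_commute)
  have u_le: "u w \<le> \<psi>1 w" for w
    using max[of w y] by (simp add: \<psi>1_def N_def a_def algebra_simps)
  have u_ge: "\<psi>2 w \<le> u w" for w
    using max[of x w] by (simp add: \<psi>2_def N_def a_def norm_minus_commute algebra_simps)
  have cont: "continuous_on UNIV \<psi>1" "continuous_on UNIV \<psi>2"
    unfolding \<psi>1_def \<psi>2_def
    by (intro continuous_intros continuous_on_radial[OF F] continuous_on_bracket)+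
  have g1: "GDERIV \<psi>1 x :> p + \<epsilon> *\<^sub>R grad_bracket \<theta> x"
  proof -
    have "GDERIV \<psi>1 x :> (2 * F1 ((norm (x - y))\<^sup>2)) *\<^sub>R (x - y)
        + ((\<epsilon> *\<^sub>R grad_bracket \<theta> x + bracket \<theta> x *\<^sub>R 0) + 0)"
      unfolding \<psi>1_def[abs_def]
      by (intro GDERIV_add GDERIV_mult GDERIV_const GDERIV_bracket GDERIV_radial[OF F] ne)
    then show ?thesis unfolding p_def N_def a_def by (simp del: gderiv_deriv)
  qed
  have g2: "GDERIV \<psi>2 y :> p - \<epsilon> *\<^sub>R grad_bracket \<theta> y"
  proof -
    have "GDERIV \<psi>2 y :> ((-1) *\<^sub>R ((2 * F1 ((norm (y - x))\<^sup>2)) *\<^sub>R (y - x)) + F ((norm (y - x))\<^sup>2) *\<^sub>R 0)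
        + (((- \<epsilon>) *\<^sub>R grad_bracket \<theta> y + bracket \<theta> y *\<^sub>R 0) + 0)"
      unfolding \<psi>2_def[abs_def]
      by (intro GDERIV_add GDERIV_mult GDERIV_const GDERIV_bracket GDERIV_radial[OF F] ne[symmetric])
    moreover have "((-1) *\<^sub>R ((2 * F1 ((norm (y - x))\<^sup>2)) *\<^sub>R (y - x)) + F ((norm (y - x))\<^sup>2) *\<^sub>R 0)
        + (((- \<epsilon>) *\<^sub>R grad_bracket \<theta> y + bracket \<theta> y *\<^sub>R 0) + 0) = p - \<epsilon> *\<^sub>R grad_bracket \<theta> y"
      by (simp add: p_def N_def a_def norm_minus_commute algebra_simps)
    ultimately show ?thesis by (simp only:)
  qed
  \<comment> \<open>For r < \<open>\<rho>\<close>: the second-difference bound applies on |z| < r,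
    this region lies in the inner branch of the majorant, and r < N / 2 keeps it disjoint from the
    ball about \<open>a\<close> that yields the gain.\<close>
  define \<rho> where "\<rho> = min \<delta> (min (N / 2) 1)"
  have \<rho>: "0 < \<rho>" using C N by (simp add: \<rho>_def)
  have key: "H (p + \<epsilon> *\<^sub>R grad_bracket \<theta> x) - H (p - \<epsilon> *\<^sub>R grad_bracket \<theta> y) + lam * vol
      \<le> Lam * ((6 * \<epsilon> + C * r powr (2 - \<mu>)) * J \<theta> s)" if r: "0 < r" "r < \<rho>" for r
  proof -
    have rN: "r < N" "r \<le> \<delta>" "r < 1" "r < N / 2" using r N C by (auto simp: \<rho>_def)
    have C2: "C2_on (ball x r) \<psi>1" "C2_on (ball y r) \<psi>2"
      unfolding \<psi>1_def \<psi>2_def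
      by (intro C2_on_add C2_on_cmult C2_on_const C2_on_bracket C2_on_radial[OF F];
          use rN in \<open>simp add: N_def a_def dist_norm norm_minus_commute\<close>)+
    define v1 where "v1 = glue x r \<psi>1 u"
    define v2 where "v2 = glue y r \<psi>2 u"
    note gl1 = glue_properties[OF r(1) C2(1) cont(1) u(3,4) \<gamma>(1), folded v1_def]
    note gl2 = glue_properties[OF r(1) C2(2) cont(2) u(3,4) \<gamma>(1), folded v2_def]
    obtain M1 M2 where M1: "\<And>y. \<bar>v1 y\<bar> \<le> M1 * (1 + norm y) powr \<gamma>"
      and M2: "\<And>y. \<bar>v2 y\<bar> \<le> M2 * (1 + norm y) powr \<gamma>"
      using gl1(3) gl2(3) by blast
    have L1: "v1 \<in> weighted_L1 s" "v2 \<in> weighted_L1 s"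
      using growth_imp_weighted_L1[OF gl1(1) \<gamma>s M1] growth_imp_weighted_L1[OF gl2(1) \<gamma>s M2] by simp_all
    have grads: "grad \<psi>1 x = p + \<epsilon> *\<^sub>R grad_bracket \<theta> x" "grad \<psi>2 y = p - \<epsilon> *\<^sub>R grad_bracket \<theta> y"
      using g1 g2 by (auto intro: grad_eqI)
    have "- I v1 x + H (grad \<psi>1 x) \<le> 0"
      using u(1) C2(1) r(1) \<psi>_at(1) u_le L1(1) unfolding visc_subsolution_def v1_def by (metis UNIV_I)
    moreover have "0 \<le> - I v2 y + H (grad \<psi>2 y)"
      using u(2) C2(2) r(1) \<psi>_at(2) u_ge L1(2) unfolding visc_supersolution_def v2_def by (metis UNIV_I)
    ultimately have visc: "H (p + \<epsilon> *\<^sub>R grad_bracket \<theta> x) - H (p - \<epsilon> *\<^sub>R grad_bracket \<theta> y) \<le> I v1 x - I v2 y"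
      unfolding grads by linarith
    \<comment> \<open>The 6 is two points times the constant 3 of
      \<open>bracket_increment_bound\<close>; the other summand pays for the second difference on
      |z| < r.\<close>
    define A where "A = 6 * \<epsilon> + C * r powr (2 - \<mu>)"
    have A0: "0 \<le> A" using \<epsilon> C by (simp add: A_def)
    define Q where "Q z = D * indicator (ball a (\<eta> * N)) z" for z
    note vb = integral_ball_lower_bound[of a, OF _ \<eta> s(1), folded n_def N_def]
    have a0: "a \<noteq> 0" using N by (auto simp: N_def)
    have intQ: "integrable lebesgue (\<lambda>z. Q z / norm z powr (n + 2 * s))"
      using integrable_mult_right[OF vb(1)[OF a0], of D] by (simp add: Q_def)
    have "I v1 x - I v2 y \<le> Lam * (LINT z|lebesgue. A * m z / norm z powr (n + 2 * s))
        - lam * (LINT z|lebesgue. Q z / norm z powr (n + 2 * s))"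
      unfolding n_def
    proof (rule elliptic_upper_bound[OF s lam I \<gamma>(1) \<gamma>s gl1(1,2) M1 gl2(1,2) M2])
      show "0 \<le> A * m z" for z using A0 m0 by simp
      show "0 \<le> Q z" for z using D by (simp add: Q_def)
      show "integrable lebesgue (\<lambda>z. A * m z / norm z powr (real DIM('a) + 2 * s))"
        using integrable_mult_right[OF intm, of A] by (simp add: n_def)
      show "integrable lebesgue (\<lambda>z. Q z / norm z powr (real DIM('a) + 2 * s))"
        using intQ by (simp add: n_def)
      fix z :: 'a assume "z \<noteq> 0"
      have v_at: "v1 x = u x" "v2 y = u y" using \<psi>_at r by (simp_all add: v1_def v2_def glue_def)
      \<comment> \<open>The radial gradient \<open>p\<close> is common to both test functions and
        cancels; what remains is exactly the correction needed for the bracket increments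
        \<open>bi\<close>.\<close>
      have cmp: "c z * ((grad v1 x - grad v2 y) \<bullet> z)
          = \<epsilon> * (c z * (grad_bracket \<theta> x \<bullet> z)) + \<epsilon> * (c z * (grad_bracket \<theta> y \<bullet> z))"
        unfolding gl1(4) gl2(4) grads by (simp add: inner_add_left inner_diff_left algebra_simps)
      have "bi x z \<le> 3 * m z" "bi y z \<le> 3 * m z" using bi[of x z] bi[of y z] by auto
      then have b6: "\<epsilon> * (bi x z + bi y z) \<le> 6 * \<epsilon> * m z"
        using mult_left_mono[of "bi x z + bi y z" "6 * m z" \<epsilon>] \<epsilon> by simp
      have "v1 (x + z) - v1 x - (v2 (y + z) - v2 y) - c z * ((grad v1 x - grad v2 y) \<bullet> z) \<le> A * m z - Q z"
      proof (cases "norm z < r \<or> z \<in> ball a (\<eta> * N)")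
        case True
        \<comment> \<open>True for every z, inside and outside the gluing balls. This is why the
          test functions may also be used near \<open>a\<close>, far from the contact
          points.\<close>
        have "v1 (x + z) \<le> \<psi>1 (x + z)" "\<psi>2 (y + z) \<le> v2 (y + z)"
          using u_le u_ge by (simp_all add: v1_def v2_def glue_def)
        then have "v1 (x + z) - v1 x - (v2 (y + z) - v2 y) - c z * ((grad v1 x - grad v2 y) \<bullet> z)
            \<le> \<psi>1 (x + z) - \<psi>1 x - (\<psi>2 (y + z) - \<psi>2 y) - c z * ((grad v1 x - grad v2 y) \<bullet> z)"
          unfolding v_at \<psi>_at by simp
        also have "\<dots> = sd z + \<epsilon> * (bi x z + bi y z)"
        proof -
          have "x + z - y = a + z" "norm (y + z - x) = norm (a - z)"
            by (simp add: a_def) (metis a_def add_diff_eq diff_diff_eq2 norm_minus_commute add.commute)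
          then show ?thesis
            unfolding cmp \<psi>1_def \<psi>2_def
            by (simp add: bi_def sd_def N_def a_def norm_minus_commute algebra_simps)
        qed
        also have "\<dots> \<le> A * m z - Q z"
        proof (cases "norm z < r")
          case zr: True
          have "z \<notin> ball a (\<eta> * N)"
          proof
            assume "z \<in> ball a (\<eta> * N)"
            then have "norm (a - z) < \<eta> * N" by (simp add: dist_norm)
            also have "\<dots> \<le> 1/2 * N" using \<eta> N by (intro mult_right_mono) auto
            finally show False using norm_triangle_ineq2[of a z] zr rN by (simp add: N_def)
          qed
          then have Q: "Q z = 0" by (simp add: Q_def)
          have "sd z \<le> C * (norm z)\<^sup>2" using sd_C zr rN by simp
          \<comment> \<open>Splitting off |z|^(2 - \<mu>) <= r^(2 - \<mu>) bounds the second
            difference by a multiple of the integrable majorant that vanishes with r.\<close>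
          also have "(norm z)\<^sup>2 = norm z powr (2 - \<mu>) * norm z powr \<mu>"
            by (simp flip: powr_add)
          also have "C * (norm z powr (2 - \<mu>) * norm z powr \<mu>) \<le> C * (r powr (2 - \<mu>) * m z)"
            using C zr rN order_exponent_bounds[OF s]
            by (intro mult_left_mono mult_mono powr_mono2) (auto simp: m_def powr_majorant_def \<mu>_def)
          finally show ?thesis using b6 Q by (simp add: A_def algebra_simps)
        next
          case False
          then have "z \<in> ball a (\<eta> * N)" using True by blast
          then have z: "norm (a - z) < \<eta> * N" and Q: "Q z = D" by (simp_all add: dist_norm Q_def)
          have "norm (a + z) = norm (2 *\<^sub>R a - (a - z))" by (simp add: scaleR_2)
          also have "\<dots> \<le> 2 * N + norm (a - z)"
            using norm_triangle_ineq4[of "2 *\<^sub>R a" "a - z"] by (simp add: N_def)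
          finally have "norm (a + z) \<le> (2 + \<eta>) * N" using z by (simp add: distrib_right)
          then have "F ((norm (a + z))\<^sup>2) \<le> F (((2 + \<eta>) * N)\<^sup>2)"
            by (intro mono power_mono) auto
          moreover have "F ((norm (a - z))\<^sup>2) \<le> F ((\<eta> * N)\<^sup>2)"
            using z by (intro mono power_mono) auto
          ultimately have "sd z \<le> - D" using D(2) by (simp add: sd_def N_def a_def)
          moreover have "6 * \<epsilon> * m z \<le> A * m z"
            using C m0 by (intro mult_right_mono) (auto simp: A_def)
          ultimately show ?thesis using b6 Q by simp
        qed
        finally show ?thesis .
      next
        case False
        then have v: "v1 (x + z) = u (x + z)" "v2 (y + z) = u (y + z)" and Q: "Q z = 0"
          by (simp_all add: v1_def v2_def glue_def Q_def dist_norm)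
        \<comment> \<open>Joint translation: (x + z, y + z) has the same difference as (x, y), so
          the radial penalty cancels in \<open>max\<close> and only bracket increments
          remain.\<close>
        have "v1 (x + z) - v1 x - (v2 (y + z) - v2 y) - c z * ((grad v1 x - grad v2 y) \<bullet> z)
            \<le> \<epsilon> * (bi x z + bi y z)"
          using max[of "x + z" "y + z"] unfolding v v_at cmp by (simp add: bi_def algebra_simps)
        also have "\<dots> \<le> A * m z"
          using b6 mult_right_mono[of "6 * \<epsilon>" A "m z"] C m0[of z] by (simp add: A_def)
        finally show ?thesis using Q by simp
      qed
      then show "v1 (x + z) - v1 x - (v2 (y + z) - v2 y) - of_bool (2 * s \<in> {1..<2}) * indicator (ball 0 1) z
          * ((grad v1 x - grad v2 y) \<bullet> z) \<le> A * m z - Q z" by (simp only: c_def)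
    qed
    also have "(LINT z|lebesgue. A * m z / norm z powr (n + 2 * s)) = A * J \<theta> s"
      unfolding J_def m_def \<mu>_def n_def times_divide_eq_right[symmetric] by (rule integral_mult_right_zero)
    finally have "I v1 x - I v2 y \<le> Lam * (A * J \<theta> s) - lam * (LINT z|lebesgue. Q z / norm z powr (n + 2 * s))" .
    moreover have "lam * vol \<le> lam * (LINT z|lebesgue. Q z / norm z powr (n + 2 * s))"
    proof (rule mult_left_mono)
      have "(LINT z|lebesgue. Q z / norm z powr (n + 2 * s))
          = D * (LINT z|lebesgue. indicator (ball a (\<eta> * N)) z / norm z powr (n + 2 * s))"
        unfolding Q_def times_divide_eq_right[symmetric] by (rule integral_mult_right_zero)
      then show "vol \<le> (LINT z|lebesgue. Q z / norm z powr (n + 2 * s))"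
        using mult_left_mono[OF vb(2)[OF a0] D(1)] by (simp only: vol_def)
    qed (use lam in simp)
    ultimately show ?thesis using visc unfolding A_def by linarith
  qed
  \<comment> \<open>In \<open>key\<close> only the right-hand side depends on r, so the limit
    removes the second-difference term and keeps the gain.\<close>
  have "((\<lambda>r. Lam * ((6 * \<epsilon> + C * r powr (2 - \<mu>)) * J \<theta> s)) \<longlongrightarrow> Lam * ((6 * \<epsilon> + C * 0) * J \<theta> s)) (at_right 0)"
  proof (intro tendsto_intros)
    have "((\<lambda>r::real. r powr (2 - \<mu>)) \<longlongrightarrow> 0 powr (2 - \<mu>)) (at_right 0)"
      using order_exponent_bounds[OF s]
      by (intro tendsto_powr' tendsto_ident_at tendsto_const) (auto simp: \<mu>_def eventually_at_filter)
    then show "((\<lambda>r::real. r powr (2 - \<mu>)) \<longlongrightarrow> 0) (at_right 0)" by simp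
  qed
  moreover have "\<forall>\<^sub>F r in at_right 0. H (p + \<epsilon> *\<^sub>R grad_bracket \<theta> x) - H (p - \<epsilon> *\<^sub>R grad_bracket \<theta> y) + lam * vol
      \<le> Lam * ((6 * \<epsilon> + C * r powr (2 - \<mu>)) * J \<theta> s)"
    using key \<rho> by (auto simp: eventually_at_right)
  ultimately have "H (p + \<epsilon> *\<^sub>R grad_bracket \<theta> x) - H (p - \<epsilon> *\<^sub>R grad_bracket \<theta> y) + lam * vol
      \<le> Lam * ((6 * \<epsilon> + C * 0) * J \<theta> s)"
    by (rule tendsto_lowerbound) simp
  then show ?thesis by (simp add: p_def vol_def N_def a_def n_def)
qed

section \<open>Liouville bound for a general penalty\<close>

text \<open>Maximum points satisfy 1 + |x| + |y| <= R with R of order \<epsilon>^(-1/(\<theta> -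
  \<gamma>)). By \<open>dist\<close> this bounds |x - y|, and by \<open>drop\<close> the gain is
  then at least a constant times \<epsilon>^q with q = \<sigma> \<rho> / (\<theta> - \<gamma>),
  below 1 by \<open>expo\<close>. The errors, including the difference of the Hamiltonians
  controlled by \<open>H\<close>, are O(\<epsilon>).\<close>

lemma liouville_bound:
  fixes u :: "'a::euclidean_space \<Rightarrow> real" and I :: "('a \<Rightarrow> real) \<Rightarrow> 'a \<Rightarrow> real" and H :: "'a \<Rightarrow> real"
  assumes s: "0 < s" "s < 1" and lam: "0 < lam" "lam \<le> Lam"
    and I: "translation_invariant s I" "elliptic s lam Lam I"
    and \<gamma>: "0 \<le> \<gamma>" "\<gamma> < \<theta>" and \<theta>: "\<theta> \<le> 1" "\<theta> < 2 * s"
    and u: "visc_subsolution s I (\<lambda>x t p. H p) UNIV u" "visc_supersolution s I (\<lambda>x t p. H p) UNIV u"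
      "continuous_on UNIV u" "\<And>x. \<bar>u x\<bar> \<le> M * (1 + norm x) powr \<gamma>" and M: "0 < M"
    and F: "radial_profile F F1" "0 \<le> F 0"
    and drop: "\<And>N. 0 < N \<Longrightarrow> \<exists>\<eta> D. 0 < \<eta> \<and> \<eta> \<le> 1/2 \<and> 0 \<le> D
        \<and> F (((2 + \<eta>) * N)\<^sup>2) + F ((\<eta> * N)\<^sup>2) - 2 * F (N\<^sup>2) \<le> - D
        \<and> c0 * (1 + N) powr - \<sigma> \<le> D * (\<eta> powr real DIM('a) * N powr (- 2 * s))"
      "0 < c0" "0 \<le> \<sigma>"
    and dist: "\<And>x y. F ((norm (x - y))\<^sup>2) < u x - u y \<Longrightarrow> 1 + norm (x - y) \<le> K * (1 + norm x + norm y) powr \<rho>"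
      "0 < K" "0 \<le> \<rho>"
    and expo: "\<sigma> * \<rho> < \<theta> - \<gamma>"
    and H: "\<And>x y e1 e2. F ((norm (x - y))\<^sup>2) < u x - u y \<Longrightarrow> norm e1 \<le> \<epsilon>0 \<Longrightarrow> norm e2 \<le> \<epsilon>0 \<Longrightarrow>
        \<bar>H ((2 * F1 ((norm (x - y))\<^sup>2)) *\<^sub>R (x - y) + e1) - H ((2 * F1 ((norm (x - y))\<^sup>2)) *\<^sub>R (x - y) - e2)\<bar>
        \<le> C * norm (e1 + e2)" "0 < \<epsilon>0"
  shows "u x0 - u y0 \<le> F ((norm (x0 - y0))\<^sup>2)"
proof (rule ccontr)
  assume "\<not> u x0 - u y0 \<le> F ((norm (x0 - y0))\<^sup>2)"
  then have pos: "0 < u x0 - u y0 - F ((norm (x0 - y0))\<^sup>2)" by simp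
  define J where "J = (LINT z|lebesgue. powr_majorant (order_exponent s) \<theta> (z::'a) / norm z powr (real DIM('a) + 2 * s))"
  define q where "q = \<sigma> * \<rho> / (\<theta> - \<gamma>)"
  define c1 where "c1 = unit_ball_vol (real DIM('a)) * 2 powr - (real DIM('a) + 2 * s)"
  define c where "c = lam * (c1 * (c0 * (K powr - \<sigma> * (4 * M) powr - q)))"
  define C' where "C' = 6 * Lam * J + 2 * \<bar>C\<bar>"
  \<comment> \<open>The first bound keeps the gradient perturbations within the range of
    \<open>H\<close>; the second keeps the penalised difference at (x0, y0) positive.\<close>
  define \<epsilon>1 where "\<epsilon>1 = min \<epsilon>0 ((u x0 - u y0 - F ((norm (x0 - y0))\<^sup>2)) / (bracket \<theta> x0 + bracket \<theta> y0))"
  have \<theta>0: "0 < \<theta>" using \<gamma> by simp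
  have q: "0 \<le> q" "q < 1" using expo \<gamma> drop(3) dist(3) by (auto simp: q_def)
  have c1: "0 < c1" by (simp add: c1_def)
  have c: "0 < c" using lam c1 drop(2) dist(2) M by (simp add: c_def)
  have \<epsilon>1: "0 < \<epsilon>1"
    using H(2) pos bracket_pos[of \<theta> x0] bracket_pos[of \<theta> y0] by (simp add: \<epsilon>1_def add_pos_pos)
  have F_nonneg: "0 \<le> F t" if "0 \<le> t" for t
    using F that unfolding radial_profile_def by (meson order_refl order_trans)
  have small: "c \<le> C' * \<epsilon> powr (1 - q)" if \<epsilon>: "0 < \<epsilon>" "\<epsilon> < \<epsilon>1" for \<epsilon>
  proof -
    define \<Phi> where "\<Phi> = (\<lambda>(x, y). u x - u y - F ((norm (x - y))\<^sup>2) - \<epsilon> * (bracket \<theta> x + bracket \<theta> y))"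
    \<comment> \<open>The solution X of \<epsilon> X^\<theta> = 4 M X^\<gamma>; beyond it the
      penalty outweighs the growth of u.\<close>
    define R where "R = (4 * M / \<epsilon>) powr (1 / (\<theta> - \<gamma>))"
    have u2: "u x - u y \<le> 2 * M * (1 + norm x + norm y) powr \<gamma>" for x y
    proof -
      have "\<bar>u x\<bar> \<le> M * (1 + norm x + norm y) powr \<gamma>" "\<bar>u y\<bar> \<le> M * (1 + norm x + norm y) powr \<gamma>"
        using \<gamma> M by (auto intro!: order_trans[OF u(4)] mult_left_mono powr_mono2)
      then show ?thesis by simp
    qed
    have far: "1 + norm x + norm y \<le> R" if "0 < \<Phi> (x, y)" for x y
    proof -
      let ?X = "1 + norm x + norm y"
      have X: "0 < ?X" by (simp add: add_pos_nonneg)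
      have "\<epsilon> * ?X powr \<theta> \<le> \<epsilon> * (2 * (bracket \<theta> x + bracket \<theta> y))"
        using bracket_sum_ge[OF \<theta>0 \<theta>(1)] \<epsilon> by (intro mult_left_mono) auto
      also have "\<dots> \<le> 4 * M * ?X powr \<gamma>"
        using that u2[of x y] F_nonneg[of "(norm (x - y))\<^sup>2"]
        by (simp add: \<Phi>_def algebra_simps)
      also have "?X powr \<theta> = ?X powr (\<theta> - \<gamma>) * ?X powr \<gamma>" by (simp flip: powr_add)
      finally have "\<epsilon> * ?X powr (\<theta> - \<gamma>) \<le> 4 * M" using X by simp
      then have "?X powr (\<theta> - \<gamma>) \<le> 4 * M / \<epsilon>" using \<epsilon> by (simp add: field_simps)
      then have "(?X powr (\<theta> - \<gamma>)) powr (1 / (\<theta> - \<gamma>)) \<le> R"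
        unfolding R_def using \<gamma> by (intro powr_mono2) auto
      then show ?thesis using X \<gamma> by (simp add: powr_powr)
    qed
    have pos0: "0 < \<Phi> (x0, y0)"
    proof -
      have "\<epsilon> < (u x0 - u y0 - F ((norm (x0 - y0))\<^sup>2)) / (bracket \<theta> x0 + bracket \<theta> y0)"
        using \<epsilon> by (simp add: \<epsilon>1_def)
      then show ?thesis
        using bracket_pos[of \<theta> x0] bracket_pos[of \<theta> y0] by (simp add: \<Phi>_def pos_less_divide_eq)
    qed
    let ?S = "cball 0 R \<times> cball 0 R :: ('a \<times> 'a) set"
    have in_S: "(x, y) \<in> ?S" if "0 < \<Phi> (x, y)" for x y
    proof -
      have "norm x \<le> R" "norm y \<le> R"
        using far[OF that] norm_ge_zero[of x] norm_ge_zero[of y] by linarith+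
      then show ?thesis by simp
    qed
    have contF: "continuous_on {0..} F" using F by (simp add: radial_profile_def)
    have "continuous_on ?S \<Phi>"
      unfolding \<Phi>_def case_prod_beta
      by (intro continuous_intros continuous_on_compose2[OF u(3)] continuous_on_compose2[OF continuous_on_bracket]
          continuous_on_compose2[OF contF]) auto
    moreover have "compact ?S" by (intro compact_Times compact_cball)
    moreover have "?S \<noteq> {}" using in_S[OF pos0] by blast
    ultimately obtain w where w: "w \<in> ?S" "\<And>v. v \<in> ?S \<Longrightarrow> \<Phi> v \<le> \<Phi> w"
      using continuous_attains_sup[of ?S \<Phi>] by blast
    obtain x y where xy: "w = (x, y)" by (cases w)
    have pos_xy: "0 < \<Phi> (x, y)" using w(2)[OF in_S[OF pos0]] pos0 by (simp add: xy)
    \<comment> \<open>Outside the compact set the penalised difference is not positive, so the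
      maximum over that set is global.\<close>
    have max: "\<Phi> (x', y') \<le> \<Phi> (x, y)" for x' y'
      using w(2)[of "(x', y')"] in_S[of x' y'] pos_xy by (cases "0 < \<Phi> (x', y')") (auto simp: xy)
    define N where "N = norm (x - y)"
    have b_pos: "0 < \<epsilon> * (bracket \<theta> x + bracket \<theta> y)"
      using \<epsilon> bracket_pos[of \<theta> x] bracket_pos[of \<theta> y] by (simp add: add_pos_pos)
    \<comment> \<open>On the diagonal \<open>u\<close> cancels and \<open>F 0\<close> is
      nonnegative, so the penalised difference is negative there. Off the diagonal the radial
      penalty is smooth.\<close>
    have ne: "x \<noteq> y"
    proof
      assume "x = y"
      then have "\<Phi> (x, y) < 0" using b_pos F(2) by (simp add: \<Phi>_def)
      then show False using pos_xy by simp
    qed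
    have gap: "F ((norm (x - y))\<^sup>2) < u x - u y" using pos_xy b_pos by (simp add: \<Phi>_def)
    have N: "0 < N" using ne by (simp add: N_def)
    from drop(1)[OF this] obtain \<eta> D where \<eta>: "0 < \<eta>" "\<eta> \<le> 1/2" and D: "0 \<le> D"
      "F (((2 + \<eta>) * N)\<^sup>2) + F ((\<eta> * N)\<^sup>2) - 2 * F (N\<^sup>2) \<le> - D"
      "c0 * (1 + N) powr - \<sigma> \<le> D * (\<eta> powr real DIM('a) * N powr (- 2 * s))" by blast
    let ?p = "(2 * F1 ((norm (x - y))\<^sup>2)) *\<^sub>R (x - y)"
    let ?e1 = "\<epsilon> *\<^sub>R grad_bracket \<theta> x" and ?e2 = "\<epsilon> *\<^sub>R grad_bracket \<theta> y"
    have est: "H (?p + ?e1) - H (?p - ?e2)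
        + lam * (D * (c1 * \<eta> powr real DIM('a) * N powr (- 2 * s))) \<le> Lam * (6 * \<epsilon> * J)"
      unfolding c1_def J_def N_def
      by (rule doubling_estimate[OF s lam I \<gamma> \<theta> u F(1) \<epsilon>(1) _ ne \<eta> D(1)])
        (use max D(2) in \<open>simp_all add: \<Phi>_def N_def\<close>)
    have e: "norm ?e1 \<le> \<epsilon>" "norm ?e2 \<le> \<epsilon>"
      using norm_grad_bracket_le[OF \<theta>0 \<theta>(1)] \<epsilon> by (simp_all add: mult_left_le)
    moreover have "\<epsilon> \<le> \<epsilon>0" using \<epsilon> by (simp add: \<epsilon>1_def)
    ultimately have "\<bar>H (?p + ?e1) - H (?p - ?e2)\<bar> \<le> C * norm (?e1 + ?e2)"
      by (intro H(1) gap order_trans[of "norm ?e1" \<epsilon> \<epsilon>0] order_trans[of "norm ?e2" \<epsilon> \<epsilon>0])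
    also have "\<dots> \<le> \<bar>C\<bar> * (2 * \<epsilon>)"
      using norm_triangle_mono[OF e] by (intro mult_mono) auto
    finally have Hd: "- (2 * \<bar>C\<bar> * \<epsilon>) \<le> H (?p + ?e1) - H (?p - ?e2)" by simp
    have "1 + N \<le> K * R powr \<rho>"
    proof -
      have "(1 + norm x + norm y) powr \<rho> \<le> R powr \<rho>"
        using far[OF pos_xy] dist(3) by (intro powr_mono2) auto
      then show ?thesis using dist(1)[OF gap] dist(2) unfolding N_def
        by (meson mult_left_mono less_imp_le order_trans)
    qed
    then have "(K * R powr \<rho>) powr - \<sigma> \<le> (1 + N) powr - \<sigma>"
      using N drop(3) by (intro powr_mono2') auto
    also have "(K * R powr \<rho>) powr - \<sigma> = K powr - \<sigma> * (4 * M / \<epsilon>) powr - q"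
      by (simp add: powr_mult R_def powr_powr q_def mult.commute)
    also have "(4 * M / \<epsilon>) powr - q = (4 * M) powr - q * \<epsilon> powr q"
      by (simp add: powr_divide powr_minus_divide)
    finally have "K powr - \<sigma> * ((4 * M) powr - q * \<epsilon> powr q) \<le> (1 + N) powr - \<sigma>" .
    then have "c0 * (K powr - \<sigma> * ((4 * M) powr - q * \<epsilon> powr q)) \<le> D * (\<eta> powr real DIM('a) * N powr (- 2 * s))"
      using D(3) drop(2) by (meson mult_left_mono less_imp_le order_trans)
    then have "lam * (c1 * (c0 * (K powr - \<sigma> * ((4 * M) powr - q * \<epsilon> powr q))))
        \<le> lam * (c1 * (D * (\<eta> powr real DIM('a) * N powr (- 2 * s))))"
      using lam c1 by (intro mult_left_mono) auto
    then have "c * \<epsilon> powr q \<le> lam * (D * (c1 * \<eta> powr real DIM('a) * N powr (- 2 * s)))"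
      by (simp add: c_def mult_ac)
    then have "c * \<epsilon> powr q \<le> C' * \<epsilon>"
      using est Hd by (simp add: C'_def algebra_simps)
    \<comment> \<open>Division by \<epsilon>^q leaves c <= C' \<epsilon>^(1 - q), which fails as
      \<epsilon> tends to 0 because q < 1.\<close>
    also have "\<dots> = C' * \<epsilon> powr (1 - q) * \<epsilon> powr q"
      using \<epsilon> by (simp add: mult.assoc flip: powr_add)
    finally show ?thesis using \<epsilon> by simp
  qed
  have "((\<lambda>\<epsilon>::real. \<epsilon> powr (1 - q)) \<longlongrightarrow> 0 powr (1 - q)) (at_right 0)"
    using q by (intro tendsto_powr' tendsto_ident_at tendsto_const) (auto simp: eventually_at_filter)
  then have "((\<lambda>\<epsilon>. C' * \<epsilon> powr (1 - q)) \<longlongrightarrow> C' * 0) (at_right 0)"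
    by (intro tendsto_mult_left) simp
  moreover have "\<forall>\<^sub>F \<epsilon> in at_right 0. c \<le> C' * \<epsilon> powr (1 - q)"
    using small \<epsilon>1 by (auto simp: eventually_at_right)
  ultimately have "c \<le> C' * 0" by (rule tendsto_lowerbound) simp
  with c show False by simp
qed

section \<open>The two penalties\<close>

lemma power2_powr:
  fixes r :: real
  assumes "0 \<le> r" shows "(r\<^sup>2) powr c = r powr (2 * c)"
  using powr_powr[of r 2 c] assms by simp

lemma radial_profile_power:
  assumes "0 < \<theta>" "0 \<le> \<delta>"
  shows "radial_profile (\<lambda>t. d + \<delta> * t powr (\<theta> / 2)) (\<lambda>t. \<delta> * (\<theta> / 2 * t powr (\<theta> / 2 - 1)))"
  unfolding radial_profile_def
proof (intro conjI exI allI impI)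
  show "continuous_on {0..} (\<lambda>t. d + \<delta> * t powr (\<theta> / 2))"
    using assms by (intro continuous_intros continuous_on_powr') auto
  show "d + \<delta> * t powr (\<theta> / 2) \<le> d + \<delta> * t' powr (\<theta> / 2)" if "0 \<le> t" "t \<le> t'" for t t'
    using that assms by (intro add_left_mono mult_left_mono powr_mono2) auto
  show "continuous_on {0<..} (\<lambda>t. \<delta> * (\<theta> / 2 * ((\<theta> / 2 - 1) * t powr (\<theta> / 2 - 1 - 1))))"
    by (intro continuous_intros) auto
  fix t :: real assume t: "0 < t"
  show "((\<lambda>t. d + \<delta> * t powr (\<theta> / 2)) has_real_derivative \<delta> * (\<theta> / 2 * t powr (\<theta> / 2 - 1))) (at t)"
  proof -
    have "((\<lambda>t. d + \<delta> * t powr (\<theta> / 2)) has_real_derivative 0 + \<delta> * (\<theta> / 2 * t powr (\<theta> / 2 - 1))) (at t)"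
      using t by (intro DERIV_add DERIV_const DERIV_cmult has_real_derivative_powr)
    then show ?thesis by (simp only: add_0)
  qed
  show "((\<lambda>t. \<delta> * (\<theta> / 2 * t powr (\<theta> / 2 - 1))) has_real_derivative
      \<delta> * (\<theta> / 2 * ((\<theta> / 2 - 1) * t powr (\<theta> / 2 - 1 - 1)))) (at t)"
    using t by (intro DERIV_cmult has_real_derivative_powr)
qed

text \<open>The power is homogeneous, so one \<eta> works at every scale, and the gain scales like
  N^(\<theta> - 2s); d drops out of the second difference. Hence \<sigma> = 2s - \<theta>, while the
  triangle inequality alone gives \<rho> = 1.\<close>

lemma liouville_power_bound:
  fixes u :: "'a::euclidean_space \<Rightarrow> real" and I :: "('a \<Rightarrow> real) \<Rightarrow> 'a \<Rightarrow> real" and H :: "'a \<Rightarrow> real"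
  assumes s: "0 < s" "s < 1" "2 * s \<le> 1" and lam: "0 < lam" "lam \<le> Lam"
    and I: "translation_invariant s I" "elliptic s lam Lam I"
    and \<gamma>: "0 \<le> \<gamma>" "\<gamma> < 2 * s" and \<theta>: "\<theta> = (6 * s + \<gamma>) / 4"
    and u: "visc_subsolution s I (\<lambda>x t p. H p) UNIV u" "visc_supersolution s I (\<lambda>x t p. H p) UNIV u"
      "continuous_on UNIV u" "\<And>x. \<bar>u x\<bar> \<le> M * (1 + norm x) powr \<gamma>" and M: "0 < M"
    and d: "0 \<le> d" and \<delta>: "0 < \<delta>"
    and H: "\<And>x y e1 e2. d + \<delta> * norm (x - y) powr \<theta> < u x - u y \<Longrightarrow> norm e1 \<le> 1 \<Longrightarrow> norm e2 \<le> 1 \<Longrightarrow>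
        \<bar>H ((\<delta> * \<theta> * norm (x - y) powr (\<theta> - 2)) *\<^sub>R (x - y) + e1)
          - H ((\<delta> * \<theta> * norm (x - y) powr (\<theta> - 2)) *\<^sub>R (x - y) - e2)\<bar> \<le> C * norm (e1 + e2)"
  shows "u x0 - u y0 \<le> d + \<delta> * norm (x0 - y0) powr \<theta>"
proof -
  \<comment> \<open>\<open>\<theta>\<close> is the midpoint of its admissible range: the exponent
    condition 2s - \<theta> < \<theta> - \<gamma> means \<theta> > (2s + \<gamma>)/2, and
    integrability at infinity asks for \<theta> < 2s.\<close>
  have \<theta>b: "0 < \<theta>" "\<theta> < 1" "\<theta> < 2 * s" "\<gamma> < \<theta>" "2 * s - \<theta> < \<theta> - \<gamma>"
    using s \<gamma> by (auto simp: \<theta> add_divide_distrib)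
  define F where "F t = d + \<delta> * t powr (\<theta> / 2)" for t
  define F1 where "F1 t = \<delta> * (\<theta> / 2 * t powr (\<theta> / 2 - 1))" for t
  have F: "radial_profile F F1"
    unfolding F_def[abs_def] F1_def[abs_def] using \<theta>b \<delta> by (intro radial_profile_power) auto
  have Fsq: "F (r\<^sup>2) = d + \<delta> * r powr \<theta>" if "0 \<le> r" for r
    using that by (simp add: F_def power2_powr)
  have F1sq: "2 * F1 (r\<^sup>2) = \<delta> * \<theta> * r powr (\<theta> - 2)" if "0 \<le> r" for r
    using that by (simp add: F1_def power2_powr right_diff_distrib)
  \<comment> \<open>The defect of strict subadditivity: (2N)^\<theta> = (2 - e) N^\<theta>.\<close>
  define e where "e = 2 - 2 powr \<theta>"
  have e: "0 < e" using powr_less_mono[of \<theta> 1 2] \<theta>b by (simp add: e_def)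
  \<comment> \<open>Small enough that the two extra terms \<eta>^\<theta>, one from each ball
    radius, consume at most half of \<open>e\<close>.\<close>
  define \<eta> where "\<eta> = min (1/2) ((e / 4) powr (1 / \<theta>))"
  have \<eta>: "0 < \<eta>" "\<eta> \<le> 1/2" using e by (auto simp: \<eta>_def)
  have \<eta>e: "2 * \<eta> powr \<theta> \<le> e / 2"
  proof -
    have "\<eta> powr \<theta> \<le> ((e / 4) powr (1 / \<theta>)) powr \<theta>"
      using \<theta>b \<eta> by (intro powr_mono2) (auto simp: \<eta>_def)
    also have "\<dots> = e / 4" using \<theta>b e by (simp add: powr_powr)
    finally show ?thesis by simp
  qed
  have "u x0 - u y0 \<le> F ((norm (x0 - y0))\<^sup>2)"
  proof (rule liouville_bound[OF s(1,2) lam I \<gamma>(1) \<theta>b(4) less_imp_le[OF \<theta>b(2)] \<theta>b(3) u M F,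
        where \<sigma> = "2 * s - \<theta>" and \<rho> = 1 and K = 1 and ?\<epsilon>0.0 = 1 and C = C
          and ?c0.0 = "\<delta> * (e / 2) * \<eta> powr real DIM('a)"])
    show "0 \<le> F 0" using d by (simp add: F_def)
    show "\<exists>h D. 0 < h \<and> h \<le> 1/2 \<and> 0 \<le> D
        \<and> F (((2 + h) * N)\<^sup>2) + F ((h * N)\<^sup>2) - 2 * F (N\<^sup>2) \<le> - D
        \<and> \<delta> * (e / 2) * \<eta> powr real DIM('a) * (1 + N) powr - (2 * s - \<theta>) \<le> D * (h powr real DIM('a) * N powr (- 2 * s))"
      if N: "0 < N" for N
    proof (intro exI conjI)
      let ?D = "\<delta> * (e / 2) * N powr \<theta>"
      show "0 < \<eta>" "\<eta> \<le> 1/2" by fact+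
      show "0 \<le> ?D" using \<delta> e by simp
      have "((2 + \<eta>) * N) powr \<theta> \<le> (2 powr \<theta> + \<eta> powr \<theta>) * N powr \<theta>"
        unfolding powr_mult using \<theta>b \<eta> by (intro mult_right_mono powr_add_le) auto
      moreover have "(\<eta> * N) powr \<theta> = \<eta> powr \<theta> * N powr \<theta>" by (rule powr_mult)
      ultimately have "((2 + \<eta>) * N) powr \<theta> + (\<eta> * N) powr \<theta> - 2 * N powr \<theta>
          \<le> (2 powr \<theta> + 2 * \<eta> powr \<theta> - 2) * N powr \<theta>" by (simp add: algebra_simps)
      also have "\<dots> \<le> (- (e / 2)) * N powr \<theta>"
        by (rule mult_right_mono) (use \<eta>e e_def in linarith, simp)
      finally have "\<delta> * (((2 + \<eta>) * N) powr \<theta> + (\<eta> * N) powr \<theta> - 2 * N powr \<theta>) \<le> \<delta> * (- (e / 2) * N powr \<theta>)"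
        using \<delta> by (intro mult_left_mono) auto
      moreover have "F (((2 + \<eta>) * N)\<^sup>2) + F ((\<eta> * N)\<^sup>2) - 2 * F (N\<^sup>2)
          = \<delta> * (((2 + \<eta>) * N) powr \<theta> + (\<eta> * N) powr \<theta> - 2 * N powr \<theta>)"
      proof -
        have "0 \<le> (2 + \<eta>) * N" "0 \<le> \<eta> * N" "0 \<le> N" using N \<eta> by simp_all
        then show ?thesis by (simp only: Fsq) (simp add: algebra_simps)
      qed
      ultimately show "F (((2 + \<eta>) * N)\<^sup>2) + F ((\<eta> * N)\<^sup>2) - 2 * F (N\<^sup>2) \<le> - ?D" by simp
      have "(1 + N) powr - (2 * s - \<theta>) \<le> N powr - (2 * s - \<theta>)"
        using N \<theta>b by (intro powr_mono2') auto
      also have "\<dots> = N powr \<theta> * N powr (- 2 * s)" by (simp flip: powr_add)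
      finally have "\<delta> * (e / 2) * \<eta> powr real DIM('a) * (1 + N) powr - (2 * s - \<theta>)
          \<le> \<delta> * (e / 2) * \<eta> powr real DIM('a) * (N powr \<theta> * N powr (- 2 * s))"
        using \<delta> e by (intro mult_left_mono) auto
      then show "\<delta> * (e / 2) * \<eta> powr real DIM('a) * (1 + N) powr - (2 * s - \<theta>)
          \<le> ?D * (\<eta> powr real DIM('a) * N powr (- 2 * s))" by (simp only: mult_ac)
    qed
    show "0 < \<delta> * (e / 2) * \<eta> powr real DIM('a)" using \<delta> e \<eta> by simp
    show "1 + norm (x - y) \<le> 1 * (1 + norm x + norm y) powr 1" for x y :: 'a
      using norm_triangle_ineq4[of x y] by (simp add: add.assoc)
    show "\<bar>H ((2 * F1 ((norm (x - y))\<^sup>2)) *\<^sub>R (x - y) + e1) - H ((2 * F1 ((norm (x - y))\<^sup>2)) *\<^sub>R (x - y) - e2)\<bar>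
        \<le> C * norm (e1 + e2)"
      if "F ((norm (x - y))\<^sup>2) < u x - u y" "norm e1 \<le> 1" "norm e2 \<le> 1" for x y e1 e2
      using H[of x y e1 e2] that by (simp add: Fsq F1sq)
  qed (use \<theta>b in auto)
  then show ?thesis by (simp add: Fsq)
qed

section \<open>The perturbed linear penalty for s > 1/2\<close>

text \<open>With \<open>r = sqrt t\<close>, the summand \<open>r / (1 + r powr \<tau>)\<close> perturbs the linear penalty \<open>\<delta> * r\<close> so that it
  becomes strictly subadditive, while the slope stays between \<open>\<delta>\<close> and \<open>2 * \<delta>\<close>, where \<open>H\<close> is
  Lipschitz.\<close>

definition linear_profile :: "real \<Rightarrow> real \<Rightarrow> real \<Rightarrow> real" where
  "linear_profile \<delta> \<tau> t = \<delta> * (t powr (1/2) + t powr (1/2) * inverse (1 + t powr (\<tau> / 2)))"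

definition linear_profile_deriv :: "real \<Rightarrow> real \<Rightarrow> real \<Rightarrow> real" where
  "linear_profile_deriv \<delta> \<tau> t = \<delta> / 2 * (t powr (- 1/2) * (1 + inverse (1 + t powr (\<tau> / 2))
      - \<tau> * (t powr (\<tau> / 2) * (inverse (1 + t powr (\<tau> / 2)))\<^sup>2)))"

lemma linear_profile_power2:
  "0 \<le> r \<Longrightarrow> linear_profile \<delta> \<tau> (r\<^sup>2) = \<delta> * (r + r / (1 + r powr \<tau>))"
  by (simp add: linear_profile_def power2_powr divide_inverse[of r])

text \<open>After clearing denominators the cross terms are r r'^\<tau> = (r r')^\<tau> r^(1 -
  \<tau>) and its mirror image, which are ordered because \<tau> <= 1.\<close>

lemma div_one_plus_powr_mono:
  fixes r r' \<tau> :: real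
  assumes "0 \<le> r" "r \<le> r'" "0 < \<tau>" "\<tau> \<le> 1"
  shows "r / (1 + r powr \<tau>) \<le> r' / (1 + r' powr \<tau>)"
proof -
  have split: "w = w powr \<tau> * w powr (1 - \<tau>)" if "0 \<le> w" for w :: real
    using that by (simp flip: powr_add)
  have "r powr (1 - \<tau>) \<le> r' powr (1 - \<tau>)" using assms by (intro powr_mono2) auto
  then have "r powr \<tau> * r' powr \<tau> * r powr (1 - \<tau>) \<le> r powr \<tau> * r' powr \<tau> * r' powr (1 - \<tau>)"
    by (intro mult_left_mono) auto
  moreover have "r * r' powr \<tau> = r powr \<tau> * r' powr \<tau> * r powr (1 - \<tau>)"
    by (subst split[OF assms(1)]) (simp only: mult_ac)
  moreover have "r' * r powr \<tau> = r powr \<tau> * r' powr \<tau> * r' powr (1 - \<tau>)"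
    using assms by (subst split[of r']) (simp_all only: mult_ac)
  ultimately have "r * (1 + r' powr \<tau>) \<le> r' * (1 + r powr \<tau>)"
    unfolding distrib_left mult_1_right using assms(2) by linarith
  moreover have "0 < 1 + r powr \<tau>" "0 < 1 + r' powr \<tau>" by (simp_all add: add_pos_nonneg)
  ultimately show ?thesis by (simp add: frac_le_eq divide_le_0_iff)
qed

lemma radial_profile_linear:
  assumes "0 < \<delta>" "0 < \<tau>" "\<tau> \<le> 1"
  shows "radial_profile (linear_profile \<delta> \<tau>) (linear_profile_deriv \<delta> \<tau>)"
  unfolding radial_profile_def
proof (intro conjI exI allI impI)
  \<comment> \<open>In terms of r = sqrt t, \<open>G\<close> is the perturbing factor 1 / (1 +
    r^\<tau>) and \<open>G'\<close> its derivative in t; the product rule then gives both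
    derivatives of the profile.\<close>
  define G where "G t = inverse (1 + t powr (\<tau> / 2))" for t
  define G' where "G' t = - (inverse (1 + t powr (\<tau> / 2)) * (\<tau> / 2 * t powr (\<tau> / 2 - 1)) * inverse (1 + t powr (\<tau> / 2)))" for t
  have nz: "1 + t powr (\<tau> / 2) \<noteq> 0" for t using powr_ge_zero[of t "\<tau> / 2"] by linarith
  show "continuous_on {0..} (linear_profile \<delta> \<tau>)"
    unfolding linear_profile_def[abs_def]
    using assms nz by (intro continuous_intros continuous_on_powr') auto
  show "linear_profile \<delta> \<tau> t \<le> linear_profile \<delta> \<tau> t'" if "0 \<le> t" "t \<le> t'" for t t'
  proof -
    have "linear_profile \<delta> \<tau> ((sqrt t)\<^sup>2) \<le> linear_profile \<delta> \<tau> ((sqrt t')\<^sup>2)"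
      using that assms
      by (subst (1 2) linear_profile_power2) (auto intro!: mult_left_mono add_mono div_one_plus_powr_mono)
    then show ?thesis using that by simp
  qed
  show "continuous_on {0<..} (\<lambda>t. \<delta> / 2 * (((- 1/2) * t powr (- 1/2 - 1)) * (1 + G t - \<tau> * (t powr (\<tau> / 2) * (G t)\<^sup>2))
      + (G' t - \<tau> * ((\<tau> / 2 * t powr (\<tau> / 2 - 1)) * (G t)\<^sup>2 + (2 * G t * G' t) * t powr (\<tau> / 2))) * t powr (- 1/2)))"
    unfolding G_def G'_def using nz by (intro continuous_intros) auto
  fix t :: real assume t: "0 < t"
  have p: "((\<lambda>t. t powr c) has_real_derivative c * t powr (c - 1)) (at t)" for c
    using t by (rule has_real_derivative_powr)
  have G: "(G has_real_derivative G' t) (at t)"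
  proof -
    have "((\<lambda>t. 1 + t powr (\<tau> / 2)) has_real_derivative 0 + \<tau> / 2 * t powr (\<tau> / 2 - 1)) (at t)"
      by (intro DERIV_add DERIV_const p)
    from DERIV_inverse'[OF this nz] show ?thesis
      unfolding G_def[abs_def] G'_def by (simp only: add_0)
  qed
  have "((\<lambda>t. \<delta> * (t powr (1/2) + t powr (1/2) * G t)) has_real_derivative
      \<delta> * (1/2 * t powr (1/2 - 1) + ((1/2 * t powr (1/2 - 1)) * G t + G' t * t powr (1/2)))) (at t)"
    by (intro DERIV_cmult DERIV_add DERIV_mult p G)
  moreover have "\<delta> * (1/2 * t powr (1/2 - 1) + ((1/2 * t powr (1/2 - 1)) * G t + G' t * t powr (1/2)))
      = linear_profile_deriv \<delta> \<tau> t"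
  proof -
    have "t powr (\<tau> / 2 - 1) * t powr (1/2) = t powr (- 1/2) * t powr (\<tau> / 2)"
      by (simp add: add.commute flip: powr_add)
    then have "G' t * t powr (1/2) = - (\<tau> / 2) * (t powr (- 1/2) * t powr (\<tau> / 2)) * (G t)\<^sup>2"
      by (simp add: G'_def G_def power2_eq_square)
    then show ?thesis
      by (simp add: linear_profile_deriv_def G_def[symmetric] algebra_simps)
  qed
  ultimately show "(linear_profile \<delta> \<tau> has_real_derivative linear_profile_deriv \<delta> \<tau> t) (at t)"
    by (simp add: linear_profile_def[abs_def] G_def[symmetric])
  have G2: "((\<lambda>t. (G t)\<^sup>2) has_real_derivative 2 * G t * G' t) (at t)"
    using DERIV_power[OF G, of 2] by (simp add: mult_ac)
  show "(linear_profile_deriv \<delta> \<tau> has_real_derivative \<delta> / 2 * (((- 1/2) * t powr (- 1/2 - 1)) * (1 + G t - \<tau> * (t powr (\<tau> / 2) * (G t)\<^sup>2))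
      + (G' t - \<tau> * ((\<tau> / 2 * t powr (\<tau> / 2 - 1)) * (G t)\<^sup>2 + (2 * G t * G' t) * t powr (\<tau> / 2))) * t powr (- 1/2))) (at t)"
    unfolding linear_profile_deriv_def[abs_def] G_def[symmetric]
    by (intro DERIV_cmult DERIV_mult DERIV_diff p G G2 DERIV_add[of "\<lambda>t. 1" 0, simplified] DERIV_const)
qed

text \<open>The derivative at r^2 times 2 r is the slope in r. It equals \<delta> (1 + q) with q =
  (1 + (1 - \<tau>) w) / (1 + w)^2 and w = r^\<tau>, and q lies in [0, 1].\<close>

lemma linear_profile_slope:
  assumes "0 \<le> \<delta>" "0 < \<tau>" "\<tau> \<le> 1" "0 < r"
  shows "\<delta> \<le> 2 * linear_profile_deriv \<delta> \<tau> (r\<^sup>2) * r" "2 * linear_profile_deriv \<delta> \<tau> (r\<^sup>2) * r \<le> 2 * \<delta>"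
proof -
  define w where "w = r powr \<tau>"
  have w: "0 < w" using assms by (simp add: w_def)
  have r1: "r powr -1 * r = 1" using assms by (simp add: powr_minus)
  define q where "q = inverse (1 + w) - \<tau> * (w * (inverse (1 + w))\<^sup>2)"
  have "2 * linear_profile_deriv \<delta> \<tau> (r\<^sup>2) * r = \<delta> * (r powr -1 * r) * (1 + inverse (1 + w) - \<tau> * (w * (inverse (1 + w))\<^sup>2))"
    using assms by (simp add: linear_profile_deriv_def power2_powr w_def del: powr_neg_one')
  then have eq: "2 * linear_profile_deriv \<delta> \<tau> (r\<^sup>2) * r = \<delta> * (1 + q)"
    unfolding r1 by (simp add: q_def)
  have q: "q = (1 + (1 - \<tau>) * w) / (1 + w)\<^sup>2"
  proof -
    have "inverse (1 + w) = (1 + w) * (inverse (1 + w))\<^sup>2"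
      using w by (simp add: power2_eq_square)
    then have "q = (1 + w) * (inverse (1 + w))\<^sup>2 - \<tau> * (w * (inverse (1 + w))\<^sup>2)"
      unfolding q_def by (simp only:)
    also have "\<dots> = (1 + (1 - \<tau>) * w) * (inverse (1 + w))\<^sup>2"
      by (simp add: algebra_simps)
    finally show ?thesis by (simp add: divide_inverse power_inverse)
  qed
  have q0: "0 \<le> q" unfolding q using w assms by simp
  have "q \<le> 1"
  proof -
    have "(1 - \<tau>) * w \<le> 1 * w" using w assms by (intro mult_right_mono) auto
    then have "1 + (1 - \<tau>) * w \<le> (1 + w)\<^sup>2" using w by (simp add: power2_eq_square algebra_simps add_increasing2)
    then show ?thesis unfolding q using w by simp
  qed
  then show "\<delta> \<le> 2 * linear_profile_deriv \<delta> \<tau> (r\<^sup>2) * r" "2 * linear_profile_deriv \<delta> \<tau> (r\<^sup>2) * r \<le> 2 * \<delta>"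
    using q0 assms mult_left_mono[of q 1 \<delta>] unfolding eq by (simp_all add: distrib_left)
qed

text \<open>For p r = r / (1 + r^\<tau>) the subadditivity defect 2 p(N) - p(2N) is 2 N E. With w =
  N^\<tau>, E = (2^\<tau> - 1) w / ((1 + w) (1 + 2^\<tau> w)), which is comparable to w for N <= 1
  and to 1/w for N > 1.\<close>

lemma inverse_one_plus_powr_gap:
  fixes N \<tau> \<kappa> :: real
  defines "E \<equiv> 1 / (1 + N powr \<tau>) - 1 / (1 + (2 * N) powr \<tau>)"
  assumes \<tau>: "0 < \<tau>" "\<tau> \<le> 1" and N: "0 < N" and \<kappa>: "0 \<le> \<kappa>"
  shows "0 < E" "E \<le> 1"
    "((2 powr \<tau> - 1) / 8) powr \<kappa> * N powr (if N \<le> 1 then \<tau> * \<kappa> else - \<tau> * \<kappa>) \<le> E powr \<kappa>"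
proof -
  define w where "w = N powr \<tau>"
  define b where "b = 2 powr \<tau>"
  have w: "0 < w" using N by (simp add: w_def)
  have b: "1 < b" "b \<le> 2"
    using \<tau> powr_less_mono[of 0 \<tau> 2] powr_mono[of \<tau> 1 2] by (auto simp: b_def)
  have E: "E = 1 / (1 + w) - 1 / (1 + b * w)" by (simp add: E_def w_def b_def powr_mult)
  have bw: "w < b * w" using b w by simp
  then show "0 < E" unfolding E using w by (simp add: frac_less2)
  have "0 \<le> 1 / (1 + b * w)" "1 / (1 + w) \<le> 1" using w b by simp_all
  then show "E \<le> 1" unfolding E by linarith
  have "E = (b - 1) * w / ((1 + w) * (1 + b * w))"
  proof -
    have "1 + w \<noteq> 0" "1 + b * w \<noteq> 0" using w bw by linarith+
    then have "E = (1 * (1 + b * w) - 1 * (1 + w)) / ((1 + w) * (1 + b * w))"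
      unfolding E by (rule diff_frac_eq)
    also have "1 * (1 + b * w) - 1 * (1 + w) = (b - 1) * w" by (simp add: algebra_simps)
    finally show ?thesis .
  qed
  also have "\<dots> \<ge> (b - 1) * w / ((1 + w) * (2 * (1 + w)))"
  proof (rule divide_left_mono)
    have "1 + b * w \<le> 1 + 2 * w" using b w by (intro add_left_mono mult_right_mono) auto
    also have "\<dots> \<le> 2 * (1 + w)" by simp
    finally have "1 + b * w \<le> 2 * (1 + w)" .
    then show "(1 + w) * (1 + b * w) \<le> (1 + w) * (2 * (1 + w))" using w by (intro mult_left_mono) simp_all
  qed (use b w in \<open>auto intro!: mult_pos_pos add_pos_pos\<close>)
  finally have E1: "(b - 1) * w / ((1 + w) * (2 * (1 + w))) \<le> E" .
  have "(b - 1) / 8 * (if N \<le> 1 then N powr \<tau> else N powr - \<tau>) \<le> E"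
  proof (cases "N \<le> 1")
    case True
    then have w1: "w \<le> 1" using \<tau> N unfolding w_def by (intro powr_le1) auto
    have "(b - 1) * w / 8 \<le> (b - 1) * w / ((1 + w) * (2 * (1 + w)))"
    proof (rule divide_left_mono)
      have "(1 + w) * (2 * (1 + w)) \<le> 2 * (2 * 2)" using w w1 by (intro mult_mono) auto
      then show "(1 + w) * (2 * (1 + w)) \<le> 8" by simp
    qed (use b w in auto)
    from order_trans[OF this E1] show ?thesis using True by (simp add: w_def)
  next
    case False
    then have w1: "1 \<le> w" using \<tau> unfolding w_def by (intro ge_one_powr_ge_zero) auto
    have "(b - 1) * w / (8 * w * w) \<le> (b - 1) * w / ((1 + w) * (2 * (1 + w)))"
    proof (rule divide_left_mono)
      have "(1 + w) * (2 * (1 + w)) \<le> (2 * w) * (2 * (2 * w))" using w w1 by (intro mult_mono) auto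
      then show "(1 + w) * (2 * (1 + w)) \<le> 8 * w * w" by simp
    qed (use b w in auto)
    note le = order_trans[OF this E1]
    have "(b - 1) * w / (8 * w * w) = (b - 1) / 8 * (1 / w)" using w by simp
    also have "1 / w = N powr - \<tau>" by (simp add: w_def powr_minus_divide)
    finally have "(b - 1) * w / (8 * w * w) = (b - 1) / 8 * N powr - \<tau>" .
    with le False show ?thesis by simp
  qed
  then have "((b - 1) / 8 * (if N \<le> 1 then N powr \<tau> else N powr - \<tau>)) powr \<kappa> \<le> E powr \<kappa>"
    using b \<kappa> by (intro powr_mono2) auto
  then show "((2 powr \<tau> - 1) / 8) powr \<kappa> * N powr (if N \<le> 1 then \<tau> * \<kappa> else - \<tau> * \<kappa>) \<le> E powr \<kappa>"
    by (cases "N \<le> 1") (simp_all only: powr_mult powr_powr b_def if_True if_False)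
qed

text \<open>Let h = E N / 4. Passing from the radii 2N and 0 to 2N + h and h costs at most 4 h = N
  E: 2 h from the linear part and 2 h from the perturbation. Half of the defect 2 N E
  survives.\<close>

lemma linear_profile_drop:
  fixes N \<tau> \<delta> :: real
  defines "E \<equiv> 1 / (1 + N powr \<tau>) - 1 / (1 + (2 * N) powr \<tau>)"
  assumes \<tau>: "0 < \<tau>" "\<tau> \<le> 1" and N: "0 < N" and \<delta>: "0 < \<delta>"
  shows "linear_profile \<delta> \<tau> (((2 + E / 4) * N)\<^sup>2) + linear_profile \<delta> \<tau> ((E / 4 * N)\<^sup>2)
    - 2 * linear_profile \<delta> \<tau> (N\<^sup>2) \<le> - (\<delta> * N * E)"
proof -
  note E = inverse_one_plus_powr_gap(1)[OF \<tau> N order_refl, folded E_def]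
  define h where "h = E / 4 * N"
  have h: "0 < h" using E N by (simp add: h_def)
  have eq: "(2 + E / 4) * N = 2 * N + h" by (simp add: h_def distrib_right)
  have pos: "0 < 1 + r powr \<tau>" for r by (simp add: add_pos_nonneg)
  have le1: "r / (1 + v powr \<tau>) \<le> r" if "0 \<le> r" for r v
  proof -
    have "r / (1 + v powr \<tau>) \<le> r / 1" using that pos by (intro divide_left_mono) auto
    then show ?thesis by simp
  qed
  have "(2 * N + h) / (1 + (2 * N + h) powr \<tau>) = 2 * N / (1 + (2 * N + h) powr \<tau>) + h / (1 + (2 * N + h) powr \<tau>)"
    by (rule add_divide_distrib)
  also have "\<dots> \<le> 2 * N / (1 + (2 * N) powr \<tau>) + h"
  proof (rule add_mono)
    have "(2 * N) powr \<tau> \<le> (2 * N + h) powr \<tau>" using \<tau> N h by (intro powr_mono2) auto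
    then show "2 * N / (1 + (2 * N + h) powr \<tau>) \<le> 2 * N / (1 + (2 * N) powr \<tau>)"
      using N pos by (intro divide_left_mono) auto
  qed (use h le1 in auto)
  finally have 1: "(2 * N + h) / (1 + (2 * N + h) powr \<tau>) \<le> 2 * N / (1 + (2 * N) powr \<tau>) + h" .
  have 2: "h / (1 + h powr \<tau>) \<le> h" using le1 h by simp
  have "(2 * N + h + (2 * N + h) / (1 + (2 * N + h) powr \<tau>)) + (h + h / (1 + h powr \<tau>)) - 2 * (N + N / (1 + N powr \<tau>))
      \<le> 4 * h + 2 * N / (1 + (2 * N) powr \<tau>) - 2 * (N / (1 + N powr \<tau>))"
  proof -
    have "(2 * N + h + A) + (h + C) - 2 * (N + D) \<le> 4 * h + B - 2 * D" if "A \<le> B + h" "C \<le> h" for A B C D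
      using that unfolding distrib_left by linarith
    from this[OF 1 2] show ?thesis .
  qed
  also have "\<dots> = - (N * E)"
  proof -
    have "2 * N / (1 + (2 * N) powr \<tau>) - 2 * (N / (1 + N powr \<tau>)) = - (2 * N * E)"
      by (simp add: E_def right_diff_distrib)
    then show ?thesis by (simp add: h_def)
  qed
  finally have le: "(2 * N + h + (2 * N + h) / (1 + (2 * N + h) powr \<tau>)) + (h + h / (1 + h powr \<tau>))
      - 2 * (N + N / (1 + N powr \<tau>)) \<le> - (N * E)" .
  have "linear_profile \<delta> \<tau> ((2 * N + h)\<^sup>2) + linear_profile \<delta> \<tau> (h\<^sup>2) - 2 * linear_profile \<delta> \<tau> (N\<^sup>2)
    = \<delta> * ((2 * N + h + (2 * N + h) / (1 + (2 * N + h) powr \<tau>)) + (h + h / (1 + h powr \<tau>)) - 2 * (N + N / (1 + N powr \<tau>)))"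
    using N h by (subst (1 2 3) linear_profile_power2) (auto simp: algebra_simps)
  also have "\<dots> \<le> \<delta> * (- (N * E))" using le \<delta> by (intro mult_left_mono) auto
  finally show ?thesis unfolding eq h_def[symmetric] by simp
qed

text \<open>Here \<theta> = 1, below 2s. As the penalty is at least \<delta> |x - y|, the growth of
  u gives \<rho> = \<gamma>. The gain is of order N E E^n N^(-2s), where E^n comes from the ball of
  radius E N / 4; hence \<sigma> = 2s - 1 + \<tau> (n + 1), and the exponent condition reads 2s
  \<gamma> + \<tau> (n + 1) \<gamma> < 1.\<close>

lemma liouville_linear_bound:
  fixes u :: "'a::euclidean_space \<Rightarrow> real" and I :: "('a \<Rightarrow> real) \<Rightarrow> 'a \<Rightarrow> real" and H :: "'a \<Rightarrow> real"
  assumes s: "1/2 < s" "s < 1" and lam: "0 < lam" "lam \<le> Lam"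
    and I: "translation_invariant s I" "elliptic s lam Lam I"
    and \<gamma>: "0 \<le> \<gamma>" "\<gamma> < 1 / (2 * s)"
    and u: "visc_subsolution s I (\<lambda>x t p. H p) UNIV u" "visc_supersolution s I (\<lambda>x t p. H p) UNIV u"
      "continuous_on UNIV u" "\<And>x. \<bar>u x\<bar> \<le> M * (1 + norm x) powr \<gamma>" and M: "0 < M"
    and H: "\<And>\<epsilon> L. 0 < \<epsilon> \<Longrightarrow> 0 < L \<Longrightarrow> \<exists>C. \<forall>p q. \<epsilon> \<le> norm p \<and> norm p \<le> L \<and> \<epsilon> \<le> norm q \<and> norm q \<le> L
        \<longrightarrow> \<bar>H p - H q\<bar> \<le> C * norm (p - q)"
    and \<delta>: "0 < \<delta>"
  shows "u x0 - u y0 \<le> 2 * \<delta> * norm (x0 - y0)"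
proof -
  define n where "n = real DIM('a)"
  \<comment> \<open>The bound by 2s - 1 keeps the gain away from 0 for small N; the bound by half of
    1 - 2s \<gamma> leaves the exponent condition strict.\<close>
  define \<tau> where "\<tau> = min 1 (min ((2 * s - 1) / (n + 1)) ((1 - 2 * s * \<gamma>) / 2 / (n + 1)))"
  define \<sigma> where "\<sigma> = 2 * s - 1 + \<tau> * (n + 1)"
  have n: "0 < n" by (simp add: n_def)
  have s\<gamma>: "2 * s * \<gamma> < 1" using \<gamma> s by (simp add: field_simps)
  have \<gamma>1: "\<gamma> < 1" using \<gamma>(2) s by (auto elim!: less_trans simp: divide_less_eq)
  have \<tau>: "0 < \<tau>" "\<tau> \<le> 1" using s s\<gamma> n by (auto simp: \<tau>_def)
  have \<tau>n: "\<tau> * (n + 1) \<le> 2 * s - 1" "\<tau> * (n + 1) \<le> (1 - 2 * s * \<gamma>) / 2"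
  proof -
    have n1: "0 < n + 1" using n by simp
    have "\<tau> \<le> (2 * s - 1) / (n + 1)" "\<tau> \<le> (1 - 2 * s * \<gamma>) / 2 / (n + 1)"
      unfolding \<tau>_def by linarith+
    then show "\<tau> * (n + 1) \<le> 2 * s - 1" "\<tau> * (n + 1) \<le> (1 - 2 * s * \<gamma>) / 2"
      unfolding pos_le_divide_eq[OF n1] .
  qed
  have \<sigma>0: "0 \<le> \<sigma>" using s \<tau> n by (simp add: \<sigma>_def)
  have expo: "\<sigma> * \<gamma> < 1 - \<gamma>"
  proof -
    have "\<tau> * (n + 1) * \<gamma> \<le> \<tau> * (n + 1)"
      using \<tau> n \<gamma>1 \<gamma> by (intro mult_left_le) auto
    also note \<tau>n(2)
    also have "(1 - 2 * s * \<gamma>) / 2 < 1 - 2 * s * \<gamma>"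
    proof -
      have "t / 2 < t" if "0 < t" for t :: real using that by simp
      then show ?thesis using s\<gamma> by (simp only: diff_gt_0_iff_gt)
    qed
    finally show ?thesis by (simp add: \<sigma>_def algebra_simps)
  qed
  define F where "F = linear_profile \<delta> \<tau>"
  define F1 where "F1 = linear_profile_deriv \<delta> \<tau>"
  have F: "radial_profile F F1"
    unfolding F_def F1_def using \<delta> \<tau> by (rule radial_profile_linear)
  have F_ge: "\<delta> * r \<le> F (r\<^sup>2)" if "0 \<le> r" for r
    using that \<delta> by (simp add: F_def linear_profile_power2 add_nonneg_nonneg)
  \<comment> \<open>The factor (1/4)^n comes from \<eta> = E / 4, the last one from the lower bound
    for E^(n + 1).\<close>
  define c0 where "c0 = \<delta> * ((1/4) powr n * ((2 powr \<tau> - 1) / 8) powr (n + 1))"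
  have "1 < 2 powr \<tau>" using \<tau> powr_less_mono[of 0 \<tau> 2] by simp
  then have "(2 powr \<tau> - 1) / 8 \<noteq> 0" using \<tau> by simp
  then have c0: "0 < c0" unfolding c0_def using \<delta> by (intro mult_pos_pos) (simp_all only: powr_gt_zero, simp)
  \<comment> \<open>The penalty gradients have norm between \<delta> and 2 \<delta> and are
    perturbed by at most \<delta> / 2, so they stay in this annulus away from 0.\<close>
  obtain C where C: "\<And>p q. \<delta> / 2 \<le> norm p \<Longrightarrow> norm p \<le> 3 * \<delta> \<Longrightarrow> \<delta> / 2 \<le> norm q \<Longrightarrow> norm q \<le> 3 * \<delta>
      \<Longrightarrow> \<bar>H p - H q\<bar> \<le> C * norm (p - q)"
    using H[of "\<delta> / 2" "3 * \<delta>"] \<delta> by auto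
  have "u x0 - u y0 \<le> F ((norm (x0 - y0))\<^sup>2)"
  proof (rule liouville_bound[OF _ s(2) lam I \<gamma>(1) \<gamma>1 order_refl _ u M F,
        where \<sigma> = \<sigma> and \<rho> = \<gamma> and K = "1 + 2 * M / \<delta>" and ?\<epsilon>0.0 = "\<delta> / 2" and C = C and ?c0.0 = c0])
    show "0 \<le> F 0" using F_ge[of 0] by simp
    show "\<exists>h D. 0 < h \<and> h \<le> 1/2 \<and> 0 \<le> D
        \<and> F (((2 + h) * N)\<^sup>2) + F ((h * N)\<^sup>2) - 2 * F (N\<^sup>2) \<le> - D
        \<and> c0 * (1 + N) powr - \<sigma> \<le> D * (h powr real DIM('a) * N powr (- 2 * s))"
      if N: "0 < N" for N
    proof -
      define E where "E = 1 / (1 + N powr \<tau>) - 1 / (1 + (2 * N) powr \<tau>)"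
      have n1: "0 \<le> n + 1" using n by simp
      note E = inverse_one_plus_powr_gap[OF \<tau> N n1, folded E_def]
      have "(1 + N) powr - \<sigma> \<le> N powr (if N \<le> 1 then \<tau> * (n + 1) else - \<tau> * (n + 1)) * N powr (1 - 2 * s)"
      proof (cases "N \<le> 1")
        case True
        have "(1 + N) powr - \<sigma> \<le> 1" using N \<sigma>0 powr_mono[of "- \<sigma>" 0 "1 + N"] by simp
        also have "1 \<le> N powr (\<tau> * (n + 1) + (1 - 2 * s))"
          using N True \<tau>n(1) powr_mono'[of "\<tau> * (n + 1) + (1 - 2 * s)" 0 N] by simp
        finally show ?thesis using True by (simp add: powr_add)
      next
        case False
        have "(1 + N) powr - \<sigma> \<le> N powr - \<sigma>" using N \<sigma>0 by (intro powr_mono2') auto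
        also have "\<dots> = N powr (- \<tau> * (n + 1)) * N powr (1 - 2 * s)"
          by (simp add: \<sigma>_def flip: powr_add)
        finally show ?thesis using False by simp
      qed
      then have "c0 * (1 + N) powr - \<sigma>
          \<le> c0 * (N powr (if N \<le> 1 then \<tau> * (n + 1) else - \<tau> * (n + 1)) * N powr (1 - 2 * s))"
        using c0 by (intro mult_left_mono) auto
      also have "\<dots> = \<delta> * ((1/4) powr n * ((((2 powr \<tau> - 1) / 8) powr (n + 1)
          * N powr (if N \<le> 1 then \<tau> * (n + 1) else - \<tau> * (n + 1))) * N powr (1 - 2 * s)))"
        by (simp only: c0_def mult_ac)
      also have "\<dots> \<le> \<delta> * ((1/4) powr n * (E powr (n + 1) * N powr (1 - 2 * s)))"
        using E(3) \<delta> by (intro mult_left_mono mult_right_mono) auto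
      also have "\<dots> = (\<delta> * N * E) * ((E / 4) powr n * N powr (- 2 * s))"
      proof -
        have "E powr (n + 1) = E * E powr n" using E(1) by (simp add: powr_add)
        moreover have "N powr (1 - 2 * s) = N * N powr (- 2 * s)"
          using N by (simp add: powr_mult_base)
        moreover have "(E / 4) powr n = (1/4) powr n * E powr n"
          by (simp flip: powr_mult)
        ultimately show ?thesis by (simp only: mult_ac)
      qed
      finally have "c0 * (1 + N) powr - \<sigma> \<le> (\<delta> * N * E) * ((E / 4) powr n * N powr (- 2 * s))" .
      moreover have "F (((2 + E / 4) * N)\<^sup>2) + F ((E / 4 * N)\<^sup>2) - 2 * F (N\<^sup>2) \<le> - (\<delta> * N * E)"
        unfolding F_def E_def by (rule linear_profile_drop[OF \<tau> N \<delta>])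
      moreover have "0 < E / 4" "E / 4 \<le> 1/2" "0 \<le> \<delta> * N * E" using E(1,2) \<delta> N by simp_all
      ultimately show ?thesis unfolding n_def by blast
    qed
    show "1 + norm (x - y) \<le> (1 + 2 * M / \<delta>) * (1 + norm x + norm y) powr \<gamma>"
      if "F ((norm (x - y))\<^sup>2) < u x - u y" for x y
    proof -
      let ?X = "(1 + norm x + norm y) powr \<gamma>"
      have "\<bar>u x\<bar> \<le> M * ?X" "\<bar>u y\<bar> \<le> M * ?X"
        using \<gamma> M by (auto intro!: order_trans[OF u(4)] mult_left_mono powr_mono2)
      then have "\<delta> * norm (x - y) \<le> 2 * M * ?X" using that F_ge[of "norm (x - y)"] by simp
      then have "norm (x - y) \<le> 2 * M / \<delta> * ?X" using \<delta> by (simp add: field_simps)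
      moreover have "1 \<le> ?X" using \<gamma> by (intro ge_one_powr_ge_zero) auto
      ultimately show ?thesis by (simp only: distrib_right mult_1_left add_mono)
    qed
    show "\<bar>H ((2 * F1 ((norm (x - y))\<^sup>2)) *\<^sub>R (x - y) + e1) - H ((2 * F1 ((norm (x - y))\<^sup>2)) *\<^sub>R (x - y) - e2)\<bar>
        \<le> C * norm (e1 + e2)"
      if "F ((norm (x - y))\<^sup>2) < u x - u y" and e: "norm e1 \<le> \<delta> / 2" "norm e2 \<le> \<delta> / 2" for x y e1 e2
    proof -
      let ?p = "(2 * F1 ((norm (x - y))\<^sup>2)) *\<^sub>R (x - y)"
      have "x \<noteq> y" using that(1) F_ge[of 0] by auto
      then have r: "0 < norm (x - y)" by simp
      note slope = linear_profile_slope[OF less_imp_le[OF \<delta>] \<tau> r, folded F1_def]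
      have "norm ?p = \<bar>2 * F1 ((norm (x - y))\<^sup>2) * norm (x - y)\<bar>" by (simp add: abs_mult)
      then have p: "\<delta> \<le> norm ?p" "norm ?p \<le> 2 * \<delta>" using slope \<delta> by linarith+
      have "\<delta> / 2 \<le> norm (?p + e1)" "norm (?p + e1) \<le> 3 * \<delta>"
        using p e \<delta> norm_triangle_ineq[of ?p e1] norm_diff_ineq[of ?p e1] by linarith+
      moreover have "\<delta> / 2 \<le> norm (?p - e2)" "norm (?p - e2) \<le> 3 * \<delta>"
        using p e \<delta> norm_triangle_ineq4[of ?p e2] norm_triangle_ineq2[of ?p e2] by linarith+
      ultimately have "\<bar>H (?p + e1) - H (?p - e2)\<bar> \<le> C * norm (?p + e1 - (?p - e2))" by (rule C)
      then show ?thesis by simp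
    qed
    show "0 < 1 + 2 * M / \<delta>" using M \<delta> by (simp add: add_pos_nonneg)
  qed (use s \<gamma> \<delta> c0 \<sigma>0 expo in auto)
  also have "\<dots> \<le> \<delta> * (norm (x0 - y0) + norm (x0 - y0))"
  proof -
    have "norm (x0 - y0) / (1 + norm (x0 - y0) powr \<tau>) \<le> norm (x0 - y0) / 1"
      by (intro divide_left_mono) (auto simp: add_pos_nonneg)
    then show ?thesis unfolding F_def using \<delta> by (simp add: linear_profile_power2)
  qed
  finally show ?thesis by simp
qed

section \<open>From the penalty bounds to constancy\<close>

lemma usc_lsc_imp_continuous_on:
  assumes "usc_on UNIV u" "lsc_on UNIV u"
  shows "continuous_on UNIV u"
  unfolding continuous_on_def
  using assms by (auto intro!: order_tendstoI simp: usc_on_def lsc_on_def)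

lemma nonpos_if_le_mult:
  fixes a b :: real
  assumes "\<And>\<delta>. 0 < \<delta> \<Longrightarrow> a \<le> \<delta> * b"
  shows "a \<le> 0"
proof (rule tendsto_lowerbound)
  show "((\<lambda>\<delta>. \<delta> * b) \<longlongrightarrow> 0) (at_right 0)"
    by (rule tendsto_eq_intros refl | simp)+
  show "\<forall>\<^sub>F \<delta> in at_right 0. a \<le> \<delta> * b"
    using assms by (auto simp: eventually_at_filter)
qed simp

lemma constant_on_UNIV_if_le:
  fixes u :: "'a \<Rightarrow> real"
  assumes "\<And>x y. u x - u y \<le> 0"
  shows "u constant_on UNIV"
  unfolding constant_on_def using assms by (meson antisym diff_le_0_iff_le)

theorem theorem1p1:
  fixes s lam Lam :: real
    and I :: "(real ^ 'n \<Rightarrow> real) \<Rightarrow> real ^ 'n \<Rightarrow> real"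
  assumes "0 < s" "s < 1" "0 < lam" "lam \<le> Lam"
    and "translation_invariant s I"
    and "positively_homogeneous s I"
    and "elliptic s lam Lam I"
  shows
    "(1/2 < s \<longrightarrow>
       (\<forall>(H :: real ^ 'n \<Rightarrow> real) (u :: real ^ 'n \<Rightarrow> real) (\<gamma> :: real) (M :: real).
          continuous_on UNIV H \<and>
          (\<forall>\<epsilon>>0. \<forall>L>0. \<exists>C. \<forall>p q.
             \<epsilon> \<le> norm p \<and> norm p \<le> L \<and> \<epsilon> \<le> norm q \<and> norm q \<le> L \<longrightarrow>
             \<bar>H p - H q\<bar> \<le> C * norm (p - q)) \<and>
          visc_solution s I (\<lambda>x t p. H p) UNIV u \<and>
          0 \<le> \<gamma> \<and> \<gamma> < 1 / (2 * s) \<and> 0 < M \<and>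
          (\<forall>x. \<bar>u x\<bar> \<le> M * (1 + norm x) powr \<gamma>) \<longrightarrow>
          u constant_on UNIV)) \<and>
     (s \<le> 1/2 \<longrightarrow>
       (\<forall>(H :: real ^ 'n \<Rightarrow> real) (u :: real ^ 'n \<Rightarrow> real) (\<gamma> :: real) (M :: real).
          continuous_on UNIV H \<and>
          visc_solution s I (\<lambda>x t p. H p) UNIV u \<and>
          0 \<le> \<gamma> \<and> \<gamma> < 2 * s \<and> 0 < M \<and>
          (\<forall>x. \<bar>u x\<bar> \<le> M * (1 + norm x) powr \<gamma>) \<and>
          ((uniformly_continuous_on UNIV u \<and>
            (\<forall>L>0. \<exists>C. \<forall>p q. norm p \<le> L \<and> norm q \<le> L \<longrightarrow>
               \<bar>H p - H q\<bar> \<le> C * norm (p - q))) \<or>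
           (\<exists>C. C-lipschitz_on UNIV H)) \<longrightarrow>
          u constant_on UNIV))"
proof (intro conjI impI allI; elim conjE)
  fix H u :: "real ^ 'n \<Rightarrow> real" and \<gamma> M :: real
  assume s: "1/2 < s" and u: "visc_solution s I (\<lambda>x t p. H p) UNIV u" "\<forall>x. \<bar>u x\<bar> \<le> M * (1 + norm x) powr \<gamma>"
    and \<gamma>: "0 \<le> \<gamma>" "\<gamma> < 1 / (2 * s)" and M: "0 < M"
    and H: "\<forall>\<epsilon>>0. \<forall>L>0. \<exists>C. \<forall>p q. \<epsilon> \<le> norm p \<and> norm p \<le> L \<and> \<epsilon> \<le> norm q \<and> norm q \<le> L \<longrightarrow>
             \<bar>H p - H q\<bar> \<le> C * norm (p - q)"
  have v: "visc_subsolution s I (\<lambda>x t p. H p) UNIV u" "visc_supersolution s I (\<lambda>x t p. H p) UNIV u"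
    using u(1) by (simp_all add: visc_solution_def)
  then have cont: "continuous_on UNIV u"
    by (intro usc_lsc_imp_continuous_on) (simp_all add: visc_subsolution_def visc_supersolution_def)
  have "u x - u y \<le> \<delta> * (2 * norm (x - y))" if "0 < \<delta>" for x y \<delta>
    using liouville_linear_bound[OF s assms(2-5,7) \<gamma> v cont _ M _ that, of x y] u(2) H by (simp add: mult_ac)
  then have "u x - u y \<le> 0" for x y by (rule nonpos_if_le_mult)
  then show "u constant_on UNIV" by (rule constant_on_UNIV_if_le)
next
  fix H u :: "real ^ 'n \<Rightarrow> real" and \<gamma> M :: real
  assume s: "s \<le> 1/2" and u: "visc_solution s I (\<lambda>x t p. H p) UNIV u" "\<forall>x. \<bar>u x\<bar> \<le> M * (1 + norm x) powr \<gamma>"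
    and \<gamma>: "0 \<le> \<gamma>" "\<gamma> < 2 * s" and M: "0 < M"
    and H: "(uniformly_continuous_on UNIV u \<and>
            (\<forall>L>0. \<exists>C. \<forall>p q. norm p \<le> L \<and> norm q \<le> L \<longrightarrow>
               \<bar>H p - H q\<bar> \<le> C * norm (p - q))) \<or>
           (\<exists>C. C-lipschitz_on UNIV H)"
  have s2: "2 * s \<le> 1" using s by simp
  define \<theta> where "\<theta> = (6 * s + \<gamma>) / 4"
  have \<theta>: "0 < \<theta>" "\<theta> < 1" using assms(1) s2 \<gamma> by (auto simp: \<theta>_def)
  have v: "visc_subsolution s I (\<lambda>x t p. H p) UNIV u" "visc_supersolution s I (\<lambda>x t p. H p) UNIV u"
    using u(1) by (simp_all add: visc_solution_def)
  then have cont: "continuous_on UNIV u"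
    by (intro usc_lsc_imp_continuous_on) (simp_all add: visc_subsolution_def visc_supersolution_def)
  let ?q = "\<lambda>\<delta> x y. (\<delta> * \<theta> * norm (x - y) powr (\<theta> - 2)) *\<^sub>R (x - y)"
  have bound: "u x - u y \<le> d + \<delta> * norm (x - y) powr \<theta>" if d: "0 < d" and \<delta>: "0 < \<delta>" for x y d \<delta>
  proof -
    \<comment> \<open>\<open>C\<close> may depend on d and \<delta>: it enters only the
      O(\<epsilon>) error for fixed penalty, and the resulting bound is free of it.\<close>
    obtain C where "\<And>x y e1 e2. d + \<delta> * norm (x - y) powr \<theta> < u x - u y \<Longrightarrow> norm e1 \<le> 1 \<Longrightarrow> norm e2 \<le> 1
        \<Longrightarrow> \<bar>H (?q \<delta> x y + e1) - H (?q \<delta> x y - e2)\<bar> \<le> C * norm (e1 + e2)"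
    proof (cases "\<exists>C. C-lipschitz_on UNIV H")
      case True
      then obtain C where C: "C-lipschitz_on UNIV H" by blast
      have "\<bar>H (p + e1) - H (p - e2)\<bar> \<le> C * norm (e1 + e2)" for p e1 e2
        using lipschitz_onD[OF C, of "p + e1" "p - e2"] by (simp add: dist_norm)
      then show ?thesis by (rule that)
    next
      case False
      with H have uc: "uniformly_continuous_on UNIV u"
        and HL: "\<And>L. 0 < L \<Longrightarrow> \<exists>C. \<forall>p q. norm p \<le> L \<and> norm q \<le> L \<longrightarrow> \<bar>H p - H q\<bar> \<le> C * norm (p - q)"
        by blast+
      \<comment> \<open>A gap above d forces |x - y| >= \<rho>. The penalty gradient has norm
        \<delta> \<theta> |x - y|^(\<theta> - 1) with a negative exponent, so it is then bounded and
        local Lipschitz continuity of \<open>H\<close> suffices.\<close>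
      obtain \<rho> where \<rho>: "0 < \<rho>" "\<And>x y. dist x y < \<rho> \<Longrightarrow> dist (u x) (u y) < d"
        using uc d unfolding uniformly_continuous_on_def by (metis UNIV_I)
      \<comment> \<open>The summand 1 leaves room for the perturbations \<open>e1\<close> and
        \<open>e2\<close>.\<close>
      define L where "L = \<delta> * \<theta> * \<rho> powr (\<theta> - 1) + 1"
      have "0 < L" using \<delta> \<theta> by (simp add: L_def add_nonneg_pos)
      from HL[OF this] obtain C where C: "\<And>p q. norm p \<le> L \<Longrightarrow> norm q \<le> L \<Longrightarrow> \<bar>H p - H q\<bar> \<le> C * norm (p - q)"
        by blast
      show ?thesis
      proof (rule that)
        fix x y e1 e2 :: "real ^ 'n"
        assume gap: "d + \<delta> * norm (x - y) powr \<theta> < u x - u y" and e: "norm e1 \<le> 1" "norm e2 \<le> 1"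
        have "0 \<le> \<delta> * norm (x - y) powr \<theta>" using \<delta> by simp
        then have "d < dist (u x) (u y)" using gap by (simp add: dist_norm)
        then have r: "\<rho> \<le> norm (x - y)" using \<rho>(2)[of x y] by (force simp: dist_norm)
        have "norm (?q \<delta> x y) = \<delta> * \<theta> * (norm (x - y) powr (\<theta> - 2) * norm (x - y))"
          using \<delta> \<theta> by (simp add: abs_mult)
        also have "norm (x - y) powr (\<theta> - 2) * norm (x - y) = norm (x - y) powr (\<theta> - 1)"
          using powr_mult_base[of "norm (x - y)" "\<theta> - 2"] by (simp add: mult.commute)
        also have "\<delta> * \<theta> * norm (x - y) powr (\<theta> - 1) \<le> \<delta> * \<theta> * \<rho> powr (\<theta> - 1)"
          using r \<rho> \<delta> \<theta> by (intro mult_left_mono powr_mono2') auto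
        finally have q: "norm (?q \<delta> x y) \<le> L - 1" by (simp add: L_def)
        have "norm (?q \<delta> x y + e1) \<le> L" "norm (?q \<delta> x y - e2) \<le> L"
          using q e norm_triangle_ineq[of "?q \<delta> x y" e1] norm_triangle_ineq4[of "?q \<delta> x y" e2] by linarith+
        then have "\<bar>H (?q \<delta> x y + e1) - H (?q \<delta> x y - e2)\<bar> \<le> C * norm (?q \<delta> x y + e1 - (?q \<delta> x y - e2))"
          by (rule C)
        then show "\<bar>H (?q \<delta> x y + e1) - H (?q \<delta> x y - e2)\<bar> \<le> C * norm (e1 + e2)" by simp
      qed
    qed
    then show ?thesis
      using liouville_power_bound[OF assms(1,2) s2 assms(3-5,7) \<gamma> \<theta>_def v cont _ M less_imp_le[OF d] \<delta>, of C x y] u(2)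
      by blast
  qed
  \<comment> \<open>With d fixed, \<delta> tends to 0 first; afterwards d does.\<close>
  have "u x - u y \<le> d" if "0 < d" for x y d
  proof -
    have "u x - u y - d \<le> 0"
      by (rule nonpos_if_le_mult[of _ "norm (x - y) powr \<theta>"]) (use bound[OF that, of _ x y] in \<open>simp add: algebra_simps\<close>)
    then show ?thesis by simp
  qed
  then have "u x - u y \<le> 0" for x y by (intro nonpos_if_le_mult[of _ 1]) simp
  then show "u constant_on UNIV" by (rule constant_on_UNIV_if_le)
qed

end
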